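(* Let $n\ge2$ and let $\epsilon$ be an arbitrary constant. On the open set $U=\{u^1\ne0,\ u^2\neq0\}$ of the space with coordinates $(u^1,\dots,u^n)$, consider: the connection $\nabla$ associated with the $n\times n$ Jordan block (Christoffel symbols $\Gamma^k_{ij}$ defined in the context); the product $\circ$ with structure constants $c^k_{ij}=\delta^k_{i+j-1}$; the vector field $e$ with components $e^i=\delta^i_1$; the dual connection $\nabla^*$ with Christoffel symbols $\Gamma^{*k}_{ij}=\Gamma^k_{ij}+(\epsilon-1)(E^{-1})^{k-i-j+2}-\epsilon\,(E^{-1})^1\,\delta^k_1\delta^1_i\delta^1_j$; the dual product $*$ with structure constants $c^{*i}_{jk}=(E^{-1})^{2+i-j-k}$; and the vector field $E$ with components $E^i=u^i$. Let $L=E\circ$ and $a_0=\epsilon u^1$. Then $(\nabla,\nabla^*,\circ,*,e,E)$ is a bi-flat F-manifold structure on $U$ satisfying $d_\nabla(L-a_0I)=0$, and it is the unique bi-flat structure with these $\circ,e,E$ satisfying $d_\nabla(L-a_0I)=0$.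
   Context: Everything is smooth (real case) or holomorphic (complex case). $E^{-1}$ is the vector field with $E^{-1}\circ E=e$; $(E^{-1})^p=0$ for $p\le0$. Christoffel symbols of $\nabla$ (symmetric in lower indices, $1\le i,j,k\le n$): $\Gamma^k_{1j}=\Gamma^k_{j1}=0$ for all $j,k$; for $i,j\ge2$, $\Gamma^k_{ij}=\Gamma^{k+4-i-j}_{22}$ if $k-i-j\ge-2$ and $\Gamma^k_{ij}=0$ if $k-i-j<-2$; $\Gamma^2_{22}=-\frac{\epsilon}{u^2}$ and $\Gamma^{p}_{22}=-\frac1{u^2}\sum_{s=1}^{p-2}u^{2+s}\Gamma^{p-s}_{22}$ for $3\le p\le n$. (In terms of the parameter $\epsilon_1$ with $a_0=\epsilon_1\operatorname{Tr}L=n\epsilon_1u^1$, one has $\epsilon=n\epsilon_1$.) For a $(1,1)$-tensor $V$ and a torsionless connection, $(d_\nabla V)^i_{jk}=\partial_jV^i_k+\Gamma^i_{jm}V^m_k-\partial_kV^i_j-\Gamma^i_{km}V^m_j$. For a vector field $X$, $X\circ$ denotes the $(1,1)$-tensor $Y\mapsto X\circ Y$. F-manifold: a manifold with a commutative associative product $\circ$ on vector fields (bilinear over functions), with unit $e$, satisfying for all vector fields $[X\circ Y,W\circ Z]-[X\circ Y,Z]\circ W-[X\circ Y,W]\circ Z-X\circ[Y,Z\circ W]+X\circ[Y,Z]\circ W+X\circ[Y,W]\circ Z-Y\circ[X,Z\circ W]+Y\circ[X,Z]\circ W+Y\circ[X,W]\circ Z=0$. Flat F-manifold (flat structure) $(\nabla,\circ,e)$: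 an F-manifold with a connection $\nabla$ such that $\nabla e=0$ and, for every constant $\lambda$, the connection $(X,Y)\mapsto\nabla_XY-\lambda X\circ Y$ is flat and torsionless. Bi-flat F-manifold $(\nabla,\nabla^*,\circ,*,e,E)$: $(\nabla,\circ,e)$ and $(\nabla^*,*,E)$ are both flat structures, $E\circ$ is invertible, and $X*Y=(E\circ)^{-1}(X\circ Y)$, $[e,E]=e$, $\mathrm{Lie}_E\circ=\circ$, $(d_\nabla-d_{\nabla^*})(X\circ)=0$ for all vector fields $X,Y$. *)

theory Defs
  imports "HOL-Analysis.Analysis"
begin

section \<open>Coordinates\<close>

text \<open>
  Coordinate space is \<open>'a ^ 'n\<close>, where \<open>'n\<close> is any finite linearly ordered type and
  \<open>n = CARD('n)\<close>.  The order serves only to number the coordinates: \<open>idx\<close> is the increasing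
  bijection from \<open>'n\<close> onto \<open>{1..n}\<close>.  It takes values in the integers because the formulas
  below use expressions such as \<open>k - i - j + 2\<close>, which may be negative.
\<close>

definition idx :: "'n::{finite,linorder} \<Rightarrow> int" where
  "idx i = int (card {j. j \<le> i})"

text \<open>\<open>coord v p\<close> is the component \<open>v\<^sup>p\<close>, with \<open>v\<^sup>p = 0\<close> for \<open>p\<close> outside \<open>{1..n}\<close>.\<close>

definition coord :: "'a::zero ^ 'n::{finite,linorder} \<Rightarrow> int \<Rightarrow> 'a" where
  "coord v p = (if p \<in> range (idx :: 'n \<Rightarrow> int) then v $ (inv idx p) else 0)"

definition pd :: "'n \<Rightarrow> ('a::real_normed_field ^ 'n::finite \<Rightarrow> 'a) \<Rightarrow> 'a ^ 'n \<Rightarrow> 'a" where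
  "pd i f x = deriv (\<lambda>t. f (x + axis i t)) 0"

section \<open>Regular functions\<close>

text \<open>
  All notions below are relative to a set \<open>\<O>\<close> of regular functions on the open set \<open>U\<close>:
  the smooth ones over the reals, the holomorphic ones over the complex numbers.
  Only the values on \<open>U\<close> matter.
\<close>

fun iter_pd :: "'n list \<Rightarrow> ('a::real_normed_field ^ 'n::finite \<Rightarrow> 'a) \<Rightarrow> 'a ^ 'n \<Rightarrow> 'a" where
  "iter_pd [] f = f"
| "iter_pd (i # is) f = pd i (iter_pd is f)"

definition smooth_functions :: "(real ^ 'n::finite) set \<Rightarrow> (real ^ 'n \<Rightarrow> real) set" where
  "smooth_functions U = {f. \<forall>is. \<forall>x\<in>U. iter_pd is f differentiable (at x)}"

text \<open>\<open>has_derivative\<close> alone is real differentiability; hence the condition that \<open>D\<close> be complex linear.\<close>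

definition holomorphic_functions :: "(complex ^ 'n::finite) set \<Rightarrow> (complex ^ 'n \<Rightarrow> complex) set" where
  "holomorphic_functions U =
     {f. \<forall>x\<in>U. \<exists>D. (f has_derivative D) (at x) \<and> (\<forall>a v. D (a *s v) = a * D v)}"

section \<open>Vector fields, products and connections\<close>

type_synonym ('a, 'n) vfield = "('a, 'n) vec \<Rightarrow> ('a, 'n) vec"

text \<open>\<open>V x i k\<close> is \<open>V\<^sup>i\<^sub>k(x)\<close>.\<close>
type_synonym ('a, 'n) tensor11 = "('a, 'n) vec \<Rightarrow> 'n \<Rightarrow> 'n \<Rightarrow> 'a"

text \<open>
  \<open>T x k i j\<close> is \<open>T\<^sup>k\<^sub>i\<^sub>j(x)\<close>: structure constants of a product (an \<open>\<O>\<close>-bilinear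
  operation on vector fields) or Christoffel symbols of a connection, with
  \<open>\<nabla>\<^sub>i \<partial>\<^sub>j = \<Gamma>\<^sup>k\<^sub>i\<^sub>j \<partial>\<^sub>k\<close>.
\<close>
type_synonym ('a, 'n) symbol3 = "('a, 'n) vec \<Rightarrow> 'n \<Rightarrow> 'n \<Rightarrow> 'n \<Rightarrow> 'a"

definition vector_fields ::
  "('a::real_normed_field ^ 'n::finite \<Rightarrow> 'a) set \<Rightarrow> ('a, 'n) vfield set" where
  "vector_fields \<O> = {X. \<forall>k. (\<lambda>x. X x $ k) \<in> \<O>}"

definition regular3 ::
  "('a::real_normed_field ^ 'n::finite \<Rightarrow> 'a) set \<Rightarrow> ('a, 'n) symbol3 \<Rightarrow> bool" where
  "regular3 \<O> T \<longleftrightarrow> (\<forall>k i j. (\<lambda>x. T x k i j) \<in> \<O>)"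

definition lie :: "('a::real_normed_field, 'n::finite) vfield \<Rightarrow> ('a, 'n) vfield \<Rightarrow> ('a, 'n) vfield" where
  "lie X Y x = (\<chi> k. \<Sum>i\<in>UNIV. X x $ i * pd i (\<lambda>y. Y y $ k) x - Y x $ i * pd i (\<lambda>y. X y $ k) x)"

definition pmult ::
  "('n \<Rightarrow> 'n \<Rightarrow> 'n \<Rightarrow> 'a) \<Rightarrow> 'a::real_normed_field ^ 'n::finite \<Rightarrow> 'a ^ 'n \<Rightarrow> 'a ^ 'n" where
  "pmult c v w = (\<chi> k. \<Sum>i\<in>UNIV. \<Sum>j\<in>UNIV. c k i j * v $ i * w $ j)"

definition vmult ::
  "('a::real_normed_field, 'n::finite) symbol3 \<Rightarrow> ('a, 'n) vfield \<Rightarrow> ('a, 'n) vfield \<Rightarrow> ('a, 'n) vfield" where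
  "vmult c X Y x = pmult (c x) (X x) (Y x)"

text \<open>The tensor \<open>X\<circ> : Y \<mapsto> X \<circ> Y\<close>.\<close>

definition mult_op ::
  "('a::real_normed_field, 'n::finite) symbol3 \<Rightarrow> ('a, 'n) vfield \<Rightarrow> ('a, 'n) tensor11" where
  "mult_op c X x i k = (\<Sum>j\<in>UNIV. c x i j k * X x $ j)"

definition vinverse ::
  "('a::real_normed_field, 'n::finite) symbol3 \<Rightarrow> ('a, 'n) vfield \<Rightarrow> ('a, 'n) vfield \<Rightarrow> ('a, 'n) vfield" where
  "vinverse c e E x = (THE v. pmult (c x) v (E x) = e x)"

definition d_nabla ::
  "('a::real_normed_field, 'n::finite) symbol3 \<Rightarrow> ('a, 'n) tensor11 \<Rightarrow>
   ('a, 'n) vec \<Rightarrow> 'n \<Rightarrow> 'n \<Rightarrow> 'n \<Rightarrow> 'a" where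
  "d_nabla \<Gamma> V x i j k =
     pd j (\<lambda>y. V y i k) x + (\<Sum>m\<in>UNIV. \<Gamma> x i j m * V x m k)
   - pd k (\<lambda>y. V y i j) x - (\<Sum>m\<in>UNIV. \<Gamma> x i k m * V x m j)"

definition nabla_vector ::
  "('a::real_normed_field, 'n::finite) symbol3 \<Rightarrow> ('a, 'n) vfield \<Rightarrow> ('a, 'n) tensor11" where
  "nabla_vector \<Gamma> X x k j = pd j (\<lambda>y. X y $ k) x + (\<Sum>m\<in>UNIV. \<Gamma> x k j m * X x $ m)"

text \<open>\<open>R\<^sup>k\<^sub>l\<^sub>i\<^sub>j\<close>, the \<open>k\<close>-th component of \<open>\<nabla>\<^sub>i\<nabla>\<^sub>j\<partial>\<^sub>l - \<nabla>\<^sub>j\<nabla>\<^sub>i\<partial>\<^sub>l\<close>.\<close>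

definition curvature ::
  "('a::real_normed_field, 'n::finite) symbol3 \<Rightarrow> ('a, 'n) vec \<Rightarrow> 'n \<Rightarrow> 'n \<Rightarrow> 'n \<Rightarrow> 'n \<Rightarrow> 'a" where
  "curvature \<Gamma> x k l i j =
     pd i (\<lambda>y. \<Gamma> y k j l) x - pd j (\<lambda>y. \<Gamma> y k i l) x
   + (\<Sum>m\<in>UNIV. \<Gamma> x k i m * \<Gamma> x m j l) - (\<Sum>m\<in>UNIV. \<Gamma> x k j m * \<Gamma> x m i l)"

definition flat_on ::
  "('a::real_normed_field ^ 'n::finite) set \<Rightarrow> ('a, 'n) symbol3 \<Rightarrow> bool" where
  "flat_on U \<Gamma> \<longleftrightarrow> (\<forall>x\<in>U. \<forall>k l i j. curvature \<Gamma> x k l i j = 0)"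

definition torsionless_on ::
  "('a::real_normed_field ^ 'n::finite) set \<Rightarrow> ('a, 'n) symbol3 \<Rightarrow> bool" where
  "torsionless_on U \<Gamma> \<longleftrightarrow> (\<forall>x\<in>U. \<forall>k i j. \<Gamma> x k i j = \<Gamma> x k j i)"

section \<open>F-manifolds, flat and bi-flat structures on an open set\<close>

definition F_manifold ::
  "('a::real_normed_field ^ 'n::finite \<Rightarrow> 'a) set \<Rightarrow> ('a ^ 'n) set \<Rightarrow>
   ('a, 'n) symbol3 \<Rightarrow> ('a, 'n) vfield \<Rightarrow> bool" where
  "F_manifold \<O> U c e \<longleftrightarrow>
     open U \<and> regular3 \<O> c \<and> e \<in> vector_fields \<O> \<and>
     (\<forall>x\<in>U. \<forall>v w. pmult (c x) v w = pmult (c x) w v) \<and>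
     (\<forall>x\<in>U. \<forall>v w z. pmult (c x) (pmult (c x) v w) z = pmult (c x) v (pmult (c x) w z)) \<and>
     (\<forall>x\<in>U. \<forall>v. pmult (c x) (e x) v = v) \<and>
     (\<forall>X\<in>vector_fields \<O>. \<forall>Y\<in>vector_fields \<O>. \<forall>W\<in>vector_fields \<O>. \<forall>Z\<in>vector_fields \<O>.
        \<forall>x\<in>U.
          lie (vmult c X Y) (vmult c W Z) x
        - vmult c (lie (vmult c X Y) Z) W x
        - vmult c (lie (vmult c X Y) W) Z x
        - vmult c X (lie Y (vmult c Z W)) x
        + vmult c (vmult c X (lie Y Z)) W x
        + vmult c (vmult c X (lie Y W)) Z x
        - vmult c Y (lie X (vmult c Z W)) x
        + vmult c (vmult c Y (lie X Z)) W x
        + vmult c (vmult c Y (lie X W)) Z x = 0)"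

text \<open>The connection \<open>(X, Y) \<mapsto> \<nabla>\<^sub>X Y - \<lambda> X \<circ> Y\<close> has Christoffel symbols \<open>\<Gamma> - \<lambda> c\<close>.\<close>

definition flat_F_manifold ::
  "('a::real_normed_field ^ 'n::finite \<Rightarrow> 'a) set \<Rightarrow> ('a ^ 'n) set \<Rightarrow>
   ('a, 'n) symbol3 \<Rightarrow> ('a, 'n) symbol3 \<Rightarrow> ('a, 'n) vfield \<Rightarrow> bool" where
  "flat_F_manifold \<O> U \<Gamma> c e \<longleftrightarrow>
     F_manifold \<O> U c e \<and> regular3 \<O> \<Gamma> \<and>
     (\<forall>x\<in>U. \<forall>k j. nabla_vector \<Gamma> e x k j = 0) \<and>
     (\<forall>l::'a. flat_on U (\<lambda>x k i j. \<Gamma> x k i j - l * c x k i j) \<and>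
               torsionless_on U (\<lambda>x k i j. \<Gamma> x k i j - l * c x k i j))"

definition bi_flat_F_manifold ::
  "('a::real_normed_field ^ 'n::finite \<Rightarrow> 'a) set \<Rightarrow> ('a ^ 'n) set \<Rightarrow>
   ('a, 'n) symbol3 \<Rightarrow> ('a, 'n) symbol3 \<Rightarrow> ('a, 'n) symbol3 \<Rightarrow> ('a, 'n) symbol3 \<Rightarrow>
   ('a, 'n) vfield \<Rightarrow> ('a, 'n) vfield \<Rightarrow> bool" where
  "bi_flat_F_manifold \<O> U \<Gamma> \<Gamma>s c cs e E \<longleftrightarrow>
     flat_F_manifold \<O> U \<Gamma> c e \<and>
     flat_F_manifold \<O> U \<Gamma>s cs E \<and>
     (\<forall>x\<in>U. bij (pmult (c x) (E x))) \<and>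
     (\<forall>x\<in>U. \<forall>v w. pmult (cs x) v w = inv (pmult (c x) (E x)) (pmult (c x) v w)) \<and>
     (\<forall>x\<in>U. lie e E x = e x) \<and>
     (\<forall>X\<in>vector_fields \<O>. \<forall>Y\<in>vector_fields \<O>. \<forall>x\<in>U.
        lie E (vmult c X Y) x - vmult c (lie E X) Y x - vmult c X (lie E Y) x = vmult c X Y x) \<and>
     (\<forall>X\<in>vector_fields \<O>. \<forall>x\<in>U. \<forall>i j k.
        d_nabla \<Gamma> (mult_op c X) x i j k - d_nabla \<Gamma>s (mult_op c X) x i j k = 0)"

section \<open>The structure associated with the Jordan block\<close>

definition jordan_domain :: "('a::real_normed_field ^ 'n::{finite,linorder}) set" where
  "jordan_domain = {u. coord u 1 \<noteq> 0 \<and> coord u 2 \<noteq> 0}"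

text \<open>\<open>gamma22 \<epsilon> u p\<close> is \<open>\<Gamma>\<^sup>p\<^sub>2\<^sub>2\<close> at \<open>u\<close>, used only for \<open>2 \<le> p \<le> n\<close>.\<close>

fun gamma22 :: "'a::real_normed_field \<Rightarrow> 'a ^ 'n::{finite,linorder} \<Rightarrow> nat \<Rightarrow> 'a" where
  "gamma22 \<epsilon> u p =
     (if p < 2 then 0
      else if p = 2 then - (\<epsilon> / coord u 2)
      else - (1 / coord u 2) * (\<Sum>s = 1..p - 2. coord u (2 + int s) * gamma22 \<epsilon> u (p - s)))"

declare gamma22.simps [simp del]

definition jordan_gamma :: "'a::real_normed_field \<Rightarrow> ('a, 'n::{finite,linorder}) symbol3" where
  "jordan_gamma \<epsilon> u k i j =
     (if idx i = 1 \<or> idx j = 1 then 0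
      else if idx k - idx i - idx j \<ge> -2 then gamma22 \<epsilon> u (nat (idx k + 4 - idx i - idx j))
      else 0)"

definition jordan_c :: "('a::real_normed_field, 'n::{finite,linorder}) symbol3" where
  "jordan_c u k i j = (if idx k = idx i + idx j - 1 then 1 else 0)"

definition jordan_e :: "('a::real_normed_field, 'n::{finite,linorder}) vfield" where
  "jordan_e u = (\<chi> i. if idx i = 1 then 1 else 0)"

definition jordan_E :: "('a::real_normed_field, 'n::{finite,linorder}) vfield" where
  "jordan_E u = u"

definition jordan_E_inv :: "('a::real_normed_field, 'n::{finite,linorder}) vfield" where
  "jordan_E_inv = vinverse jordan_c jordan_e jordan_E"

definition jordan_dual_gamma :: "'a::real_normed_field \<Rightarrow> ('a, 'n::{finite,linorder}) symbol3" where
  "jordan_dual_gamma \<epsilon> u k i j =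
     jordan_gamma \<epsilon> u k i j
   + (\<epsilon> - 1) * coord (jordan_E_inv u) (idx k - idx i - idx j + 2)
   - (if idx k = 1 \<and> idx i = 1 \<and> idx j = 1 then \<epsilon> * coord (jordan_E_inv u) 1 else 0)"

definition jordan_dual_c :: "('a::real_normed_field, 'n::{finite,linorder}) symbol3" where
  "jordan_dual_c u i j k = coord (jordan_E_inv u) (2 + idx i - idx j - idx k)"

text \<open>\<open>L - a\<^sub>0 I\<close> with \<open>L = E\<circ>\<close> and \<open>a\<^sub>0 = \<epsilon> u\<^sup>1\<close>.\<close>

definition jordan_V :: "'a::real_normed_field \<Rightarrow> ('a, 'n::{finite,linorder}) tensor11" where
  "jordan_V \<epsilon> u i k = mult_op jordan_c jordan_E u i k - (if i = k then \<epsilon> * coord u 1 else 0)"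

text \<open>Bi-flat structures with the above \<open>\<circ>\<close>, \<open>e\<close>, \<open>E\<close> and \<open>d\<^sub>\<nabla>(L - a\<^sub>0 I) = 0\<close>.\<close>

definition jordan_bi_flat ::
  "('a::real_normed_field ^ 'n::{finite,linorder} \<Rightarrow> 'a) set \<Rightarrow> 'a \<Rightarrow>
   ('a, 'n) symbol3 \<Rightarrow> ('a, 'n) symbol3 \<Rightarrow> ('a, 'n) symbol3 \<Rightarrow> bool" where
  "jordan_bi_flat \<O> \<epsilon> \<Gamma> \<Gamma>s cs \<longleftrightarrow>
     bi_flat_F_manifold \<O> jordan_domain \<Gamma> \<Gamma>s jordan_c cs jordan_e jordan_E \<and>
     (\<forall>u\<in>jordan_domain. \<forall>i j k. d_nabla \<Gamma> (jordan_V \<epsilon>) u i j k = 0)"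

end

theory Submission
  imports Defs
begin

text \<open>
  The product \<open>\<circ>\<close> identifies the tangent space with \<open>K[X]/(X^n)\<close>, where \<open>\<partial>\<^sub>i\<close> becomes
  \<open>X^(i-1)\<close>.  Write \<open>u\<close> for the series of the point, \<open>f\<^sub>0\<close> for a constant term and
  \<open>f' = (f - f\<^sub>0)/X\<close>.  The recursion for \<open>\<Gamma>\<^sup>p\<^sub>2\<^sub>2\<close> says that these symbols are the coefficients
  of \<open>\<gamma> = -\<epsilon>/u'\<close>, and every connection of the two pencils has the form
  \<open>b(f,g) = X f' g' \<gamma> + s f g - \<kappa> f\<^sub>0 g\<^sub>0\<close>: for \<open>\<nabla> - \<lambda>\<circ>\<close> take \<open>s = -\<lambda>\<close>, \<open>\<kappa> = 0\<close>, and for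
  \<open>\<nabla>\<^sup>* - \<lambda>*\<close> take \<open>s = (\<epsilon>-1-\<lambda>)/u\<close>, \<open>\<kappa> = \<epsilon>/u\<^sub>0\<close>.  The derivative of \<open>b\<close> in direction \<open>h\<close> is
  symmetric in \<open>h\<close> and the first argument, and \<open>b(h,b(k,g))\<close> is symmetric in \<open>h,k\<close> as soon as
  \<open>\<gamma>(s - s\<^sub>0) = X s \<kappa>\<close>; so all these connections are flat.

  For uniqueness, let \<open>H\<close> be the difference of two candidates for \<open>\<nabla>\<close>.  It is symmetric,
  \<open>H(v,e) = 0\<close>, and \<open>d\<^sub>\<nabla>(L - a\<^sub>0 I) = 0\<close> gives \<open>H(v,E) = 0\<close>, hence \<open>H(v,t) = 0\<close> for \<open>t = E - u\<^sup>1 e\<close>.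
  The part of the curvature of \<open>\<nabla> - \<lambda>\<circ>\<close> linear in \<open>\<lambda>\<close> then yields
  \<open>H(v, t \<circ> w) = t \<circ> H(v,w)\<close>, and \<open>H = 0\<close> because the powers of \<open>t\<close> span the algebra when
  \<open>u\<^sup>2 \<noteq> 0\<close>.  The difference \<open>H\<close> of two dual connections satisfies \<open>H(v,w) = H(e, v \<circ> w)\<close> and
  \<open>H(v,E) = 0\<close>, and \<open>E\<close> is invertible.
\<close>

section \<open>Truncated power series\<close>

text \<open>Numbering from 0 instead of 1, so that \<open>pos i\<close> is the exponent of the
  monomial that represents the i-th coordinate field.\<close>

definition pos :: "'n::{finite,linorder} \<Rightarrow> nat" where
  "pos i = card {j. j < i}"

lemma idx_eq_pos: "idx i = int (pos i) + 1"
proof -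
  have "{j. j \<le> i} = insert i {j. j < i}" by auto
  then show ?thesis by (simp add: idx_def pos_def)
qed

lemma pos_strict_mono: "i < j \<Longrightarrow> pos i < pos j"
  unfolding pos_def by (rule psubset_card_mono) auto

lemma pos_eq_iff [simp]: "pos i = pos j \<longleftrightarrow> i = j"
  using pos_strict_mono[of i j] pos_strict_mono[of j i] by (cases i j rule: linorder_cases) auto

lemma pos_less [simp]: "pos (i::'n::{finite,linorder}) < CARD('n)"
  unfolding pos_def by (rule psubset_card_mono) auto

lemma bij_betw_pos: "bij_betw (pos :: 'n::{finite,linorder} \<Rightarrow> nat) UNIV {..<CARD('n)}"
proof -
  have "inj (pos :: 'n \<Rightarrow> nat)" by (simp add: inj_def)
  moreover have "range (pos :: 'n \<Rightarrow> nat) = {..<CARD('n)}"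
    by (rule card_subset_eq) (auto simp: card_image \<open>inj pos\<close>)
  ultimately show ?thesis by (simp add: bij_betw_def)
qed

lemma obtain_pos:
  fixes p :: nat
  assumes "p < CARD('n)"
  obtains i :: "'n::{finite,linorder}" where "pos i = p"
  using assms bij_betw_pos[where 'n='n] unfolding bij_betw_def by (metis imageE lessThan_iff)

lemma coord_pos: "coord v (int (pos i) + 1) = v $ i"
proof -
  have "inj (idx :: 'b \<Rightarrow> int)" by (simp add: inj_def idx_eq_pos)
  then show ?thesis by (simp add: coord_def flip: idx_eq_pos)
qed

lemma coord_eq_0: "p < 1 \<or> int CARD('n) < p \<Longrightarrow> coord (v :: 'a::zero ^ 'n::{finite,linorder}) p = 0"
proof -
  assume "p < 1 \<or> int CARD('n) < p"
  moreover have "1 \<le> idx i \<and> idx i \<le> int CARD('n)" for i :: 'n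
    using pos_less[of i] unfolding idx_eq_pos by linarith
  ultimately have "p \<notin> range (idx :: 'n \<Rightarrow> int)" by (metis rangeE not_le)
  then show ?thesis by (simp add: coord_def)
qed

section \<open>Vectors as truncated power series\<close>

text \<open>Series stand for elements of K[X]/(X^n), so that reciprocals and shifts are available
  without a quotient type. \<open>ser\<close> picks the representative of degree below n; truncation
  happens only in \<open>vec_of\<close>.\<close>

definition ser :: "'a::zero ^ 'n::{finite,linorder} \<Rightarrow> 'a fps" where
  "ser v = Abs_fps (\<lambda>p. coord v (int p + 1))"

definition vec_of :: "'a fps \<Rightarrow> 'a ^ 'n::{finite,linorder}" where
  "vec_of f = (\<chi> i. fps_nth f (pos i))"

lemma vec_of_nth [simp]: "vec_of f $ i = fps_nth f (pos i)"
  by (simp add: vec_of_def)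

lemma ser_nth_pos [simp]: "fps_nth (ser v) (pos i) = v $ i"
  by (simp add: ser_def coord_pos)

lemma ser_nth_beyond: "CARD('n) \<le> p \<Longrightarrow> fps_nth (ser (v :: 'a::zero ^ 'n::{finite,linorder})) p = 0"
  by (simp add: ser_def coord_eq_0)

lemma coord_ser: "1 \<le> p \<Longrightarrow> coord v p = fps_nth (ser v) (nat (p - 1))"
  by (simp add: ser_def)

lemma vec_of_ser [simp]: "vec_of (ser v) = v"
  by (simp add: vec_eq_iff)

lemma vec_of_eq_iff:
  fixes f :: "'a fps"
  shows "(vec_of f :: 'a ^ 'n::{finite,linorder}) = vec_of g \<longleftrightarrow> (\<forall>p<CARD('n). fps_nth f p = fps_nth g p)"
  using pos_less by (auto simp: vec_eq_iff) (metis obtain_pos)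

lemma ser_nth_vec_of:
  "p < CARD('n) \<Longrightarrow> fps_nth (ser (vec_of f :: 'a::zero ^ 'n::{finite,linorder})) p = fps_nth f p"
  by (metis obtain_pos ser_nth_pos vec_of_nth)

lemma ser_eqI:
  assumes "\<And>i::'n::{finite,linorder}. fps_nth f (pos i) = v $ i"
    and "\<And>p. CARD('n) \<le> p \<Longrightarrow> fps_nth f p = 0"
  shows "ser v = f"
proof (rule fps_ext)
  fix p show "fps_nth (ser v) p = fps_nth f p"
    using assms ser_nth_beyond[of p v] ser_nth_pos[of v] by (metis not_le obtain_pos)
qed

lemma ser_axis: "ser (axis i a) = fps_const a * fps_X ^ pos i"
  by (rule ser_eqI) (auto simp: axis_def fps_X_power_nth, metis pos_less leD)

lemma ser_add: "ser (v + w :: 'a::monoid_add ^ 'n::{finite,linorder}) = ser v + ser w"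
  by (rule ser_eqI) (auto simp: ser_nth_beyond)

lemma ser_diff: "ser (v - w :: 'a::group_add ^ 'n::{finite,linorder}) = ser v - ser w"
  by (rule ser_eqI) (auto simp: ser_nth_beyond)

lemma ser_scale: "ser (a *s v :: 'a::comm_ring_1 ^ 'n::{finite,linorder}) = fps_const a * ser v"
  by (rule ser_eqI) (auto simp: ser_nth_beyond)

lemma ser_conv_sum:
  "ser (v :: 'a::comm_ring_1 ^ 'n::{finite,linorder}) = (\<Sum>i\<in>UNIV. fps_const (v $ i) * fps_X ^ pos i)"
  by (rule ser_eqI)
    (auto simp: fps_sum_nth fps_X_power_nth if_distrib cong: if_cong intro!: sum.neutral, metis pos_less leD)

text \<open>The truncation error has no coefficient below X^n and is therefore divisible by
  X^n.\<close>

lemma ser_vec_of_decomp: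
  obtains r where "ser (vec_of f :: 'a::comm_ring_1 ^ 'n::{finite,linorder}) = f + fps_X ^ CARD('n) * r"
proof
  let ?d = "ser (vec_of f :: ('a, 'n) vec) - f"
  have "?d = fps_X ^ CARD('n) * fps_shift CARD('n) ?d"
    by (rule fps_ext) (simp add: fps_X_power_mult_nth ser_nth_vec_of)
  then show "ser (vec_of f :: ('a, 'n) vec) = f + fps_X ^ CARD('n) * fps_shift CARD('n) ?d"
    by (metis add_diff_cancel_left' diff_add_cancel add.commute)
qed

section \<open>Bilinear forms on power series\<close>

text \<open>\<open>fps_shift 1 f\<close> is (f - f_0)/X. The family contains the products as well:
  \<open>\<gamma> = 0\<close> and \<open>\<kappa> = 0\<close> with s = 1 or s = 1/u give the two
  multiplications.\<close>

definition bform :: "'a::comm_ring_1 fps \<Rightarrow> 'a fps \<Rightarrow> 'a \<Rightarrow> 'a fps \<Rightarrow> 'a fps \<Rightarrow> 'a fps" where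
  "bform \<gamma> s \<kappa> f g = fps_X * fps_shift 1 f * fps_shift 1 g * \<gamma> + s * f * g
     - fps_const (\<kappa> * fps_nth f 0 * fps_nth g 0)"

lemma fps_decomp: "fps_const (fps_nth f 0) + fps_X * fps_shift 1 f = (f :: 'a::comm_ring_1 fps)"
  by (rule fps_ext) simp

lemma fps_shift_one_X_mult: "fps_shift 1 (fps_X * f) = (f :: 'a::comm_ring_1 fps)"
  by (rule fps_ext) simp

lemma fps_shift_one_const: "fps_shift 1 (fps_const c) = (0 :: 'a::comm_ring_1 fps)"
  by (rule fps_ext) simp

lemma bform_commute: "bform \<gamma> s \<kappa> f g = bform \<gamma> s \<kappa> g f"
  by (simp add: bform_def mult_ac)

lemma bform_add_right: "bform \<gamma> s \<kappa> f (g + h) = bform \<gamma> s \<kappa> f g + bform \<gamma> s \<kappa> f h"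
  by (simp add: bform_def fps_shift_add algebra_simps flip: fps_const_add)

lemma bform_scale_right: "bform \<gamma> s \<kappa> f (fps_const c * g) = fps_const c * bform \<gamma> s \<kappa> f g"
proof -
  have "fps_shift 1 (fps_const c * g) = fps_const c * fps_shift 1 g"
    by (rule fps_ext) simp
  then show ?thesis by (simp add: bform_def algebra_simps flip: fps_const_mult)
qed

lemma bform_sum_right: "bform \<gamma> s \<kappa> f (\<Sum>i\<in>I. fps_const (c i) * g i) = (\<Sum>i\<in>I. fps_const (c i) * bform \<gamma> s \<kappa> f (g i))"
proof (induction I rule: infinite_finite_induct)
  case (insert i I) then show ?case by (simp add: bform_add_right bform_scale_right)
qed (simp_all add: bform_def)

lemma bform_ser_right:
  "bform \<gamma> s \<kappa> f (ser w) = (\<Sum>m\<in>UNIV. fps_const (w $ m) * bform \<gamma> s \<kappa> f (fps_X ^ pos m))"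
  by (simp add: ser_conv_sum bform_sum_right)

text \<open>Multiples of X^n go to multiples of X^n: the shift loses one power of X, the factor X of
  the first summand restores it, and the constant term vanishes because n > 0. An inner truncation
  is therefore invisible after the outer one.\<close>

lemma bform_ser_vec_of:
  "vec_of (bform \<gamma> s \<kappa> f (ser (vec_of g :: 'a::comm_ring_1 ^ 'n::{finite,linorder})))
     = (vec_of (bform \<gamma> s \<kappa> f g) :: ('a, 'n) vec)"
proof -
  obtain r where r: "ser (vec_of g :: ('a, 'n) vec) = g + fps_X ^ CARD('n) * r"
    by (rule ser_vec_of_decomp)
  obtain m where m: "CARD('n) = Suc m" using not0_implies_Suc[of "CARD('n)"] by auto
  have "bform \<gamma> s \<kappa> f (fps_X ^ CARD('n) * r) = fps_X ^ CARD('n) * (fps_shift 1 f * r * \<gamma> + s * f * r)"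
  proof -
    have "fps_shift 1 (fps_X ^ CARD('n) * r) = fps_X ^ m * r"
      using fps_shift_one_X_mult[of "fps_X ^ m * r"] by (simp add: m mult.assoc)
    then show ?thesis
      by (simp add: bform_def m algebra_simps)
  qed
  then show ?thesis
    by (simp add: r bform_add_right vec_of_eq_iff fps_X_power_mult_nth)
qed

text \<open>Bilinearity carries the formula from monomials, which represent the coordinate fields,
  to all vectors.\<close>

lemma pmult_bform:
  assumes "\<And>k i j. c k i j = fps_nth (bform \<gamma> s \<kappa> (fps_X ^ pos i) (fps_X ^ pos j)) (pos k)"
  shows "pmult c v w = vec_of (bform \<gamma> s \<kappa> (ser v) (ser w))"
proof -
  have "bform \<gamma> s \<kappa> (ser v) (ser w)
      = (\<Sum>i\<in>UNIV. \<Sum>j\<in>UNIV. fps_const (w $ j) * (fps_const (v $ i) * bform \<gamma> s \<kappa> (fps_X ^ pos i) (fps_X ^ pos j)))"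
    by (subst sum.swap) (simp add: bform_ser_right bform_commute[of _ _ _ "ser v"] bform_commute[of _
        _ _ "fps_X ^ _" "fps_X ^ _"] sum_distrib_left)
  then show ?thesis
    by (simp add: vec_eq_iff pmult_def assms fps_sum_nth mult_ac)
qed

text \<open>This symmetry kills the quadratic part of the curvature. With every series split into
  its constant term and X times its shift, the difference of the two sides becomes
  \<open>(h * k0 - k * h0) * g0 * (\<gamma> * s1 - s * ?K)\<close>; the hypothesis is X times the
  vanishing of the last factor.\<close>

lemma bform_assoc_symmetric:
  fixes \<gamma> s :: "'a::comm_ring_1 fps"
  assumes "\<gamma> * (s - fps_const (fps_nth s 0)) = fps_X * s * fps_const \<kappa>"
  shows "bform \<gamma> s \<kappa> h (bform \<gamma> s \<kappa> k g) = bform \<gamma> s \<kappa> k (bform \<gamma> s \<kappa> h g)"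
proof -
  define h0 h1 k0 k1 g0 g1 s0 s1 where
    "h0 = fps_const (fps_nth h 0)" "h1 = fps_shift 1 h"
    "k0 = fps_const (fps_nth k 0)" "k1 = fps_shift 1 k"
    "g0 = fps_const (fps_nth g 0)" "g1 = fps_shift 1 g"
    "s0 = fps_const (fps_nth s 0)" "s1 = fps_shift 1 s"
  note d = this
  let ?X = "fps_X :: 'a fps" and ?K = "fps_const \<kappa>"
  have e: "h = h0 + ?X * h1" "k = k0 + ?X * k1" "g = g0 + ?X * g1" "s = s0 + ?X * s1"
    unfolding d by (simp_all only: fps_decomp)
  have "?X * (\<gamma> * s1) = ?X * (s * ?K)"
    using assms unfolding d(7)[symmetric] by (subst (asm) (1) e(4)) (simp add: algebra_simps)
  then have rel: "\<gamma> * s1 = s * ?K" 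
    using fps_shift_one_X_mult by metis
  \<comment> \<open>The form is written as a constant plus X times a remainder; the shift forgets
    the constant and returns the remainder.\<close>
  have sh: "fps_shift 1 (bform \<gamma> s \<kappa> f g) = fps_shift 1 f * g1 * \<gamma> + s1 * f * g + s0 * (fps_shift 1 f * g
      + fps_const (fps_nth f 0) * g1)" 
    (is "_ = ?r") for f
  proof -
    define f0 f1 where f01: "f0 = fps_const (fps_nth f 0)" "f1 = fps_shift 1 f"
    have f: "f = f0 + ?X * f1" unfolding f01 by (simp only: fps_decomp)
    have "s * f * g = s0 * f0 * g0 + ?X * (s1 * f * g + s0 * (f1 * g + f0 * g1))"
      by (simp only: e f) (simp add: algebra_simps)
    then have "bform \<gamma> s \<kappa> f g = ?X * ?r + fps_const (fps_nth s 0 * fps_nth f 0 * fps_nth g 0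
        - \<kappa> * fps_nth f 0 * fps_nth g 0)"
      unfolding bform_def d(6)[symmetric] by (simp add: d(5,7) f01 algebra_simps flip: fps_const_mult fps_const_sub)
    then show ?thesis by (simp only: fps_shift_add fps_shift_one_X_mult fps_shift_one_const add_0_right)
  qed
  \<comment> \<open>The letters are arbitrary ring elements here, so this is a plain polynomial
    identity; the series enter afterwards by folding \<open>e\<close>.\<close>
  have ring_id: "\<And>h0 x h1 k0 k1 g0 g1 s0 s1 \<gamma> K :: 'a fps.
    x * h1 * (k1 * g1 * \<gamma> + s1 * (k0 + x * k1) * (g0 + x * g1) + s0 * (k1 * (g0 + x * g1) + k0 * g1)) * \<gamma>
     + (s0 + x * s1) * (h0 + x * h1) * (x * k1 * g1 * \<gamma> + (s0 + x * s1) * (k0 + x * k1) * (g0 + x * g1) - K * k0 * g0)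
     - K * h0 * ((s0 - K) * k0 * g0)
     - (x * k1 * (h1 * g1 * \<gamma> + s1 * (h0 + x * h1) * (g0 + x * g1) + s0 * (h1 * (g0 + x * g1) + h0 * g1)) * \<gamma>
     + (s0 + x * s1) * (k0 + x * k1) * (x * h1 * g1 * \<gamma> + (s0 + x * s1) * (h0 + x * h1) * (g0 + x * g1) - K * h0 * g0)
     - K * k0 * ((s0 - K) * h0 * g0))
     = ((h0 + x * h1) * k0 - (k0 + x * k1) * h0) * g0 * (\<gamma> * s1 - (s0 + x * s1) * K)"
    by (simp add: algebra_simps)
  \<comment> \<open>The summand with \<open>\<gamma>\<close> carries a factor X, so only the other
    two contribute to the constant term.\<close>
  have n0: "fps_const (\<kappa> * a * fps_nth (bform \<gamma> s \<kappa> f g) 0) = ?K * fps_const a * ((s0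
      - ?K) * fps_const (fps_nth f 0) * g0)" for a f
    by (simp add: bform_def d algebra_simps)
  have "bform \<gamma> s \<kappa> h (bform \<gamma> s \<kappa> k g) = ?X * h1 * (k1 * g1 * \<gamma> + s1 * k * g + s0 * (k1 * g + k0 * g1)) * \<gamma>
     + s * h * (?X * k1 * g1 * \<gamma> + s * k * g - ?K * k0 * g0) - ?K * h0 * ((s0 - ?K) * k0 * g0)"
    unfolding bform_def[of _ _ _ h "bform \<gamma> s \<kappa> k g"] sh n0
    unfolding bform_def d by (simp flip: fps_const_mult)
  moreover have "bform \<gamma> s \<kappa> k (bform \<gamma> s \<kappa> h g) = ?X * k1 * (h1 * g1 * \<gamma> + s1 * h * g + s0 * (h1 * g + h0 * g1)) * \<gamma>
     + s * k * (?X * h1 * g1 * \<gamma> + s * h * g - ?K * h0 * g0) - ?K * k0 * ((s0 - ?K) * h0 * g0)"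
    unfolding bform_def[of _ _ _ k "bform \<gamma> s \<kappa> h g"] sh n0
    unfolding bform_def d by (simp flip: fps_const_mult)
  ultimately have "bform \<gamma> s \<kappa> h (bform \<gamma> s \<kappa> k g) - bform \<gamma> s \<kappa> k (bform \<gamma> s \<kappa> h g)
      = (h * k0 - k * h0) * g0 * (\<gamma> * s1 - s * ?K)"
    using ring_id[of ?X h1 k1 g1 \<gamma> s1 k0 g0 s0 h0 ?K, folded e] by simp
  then show ?thesis by (simp add: rel)
qed

section \<open>Linear derivatives\<close>

text \<open>Linearity over the field is automatic for the reals and means complex linearity for the
  complex numbers, so one notion serves both cases.\<close>

definition K_derivative ::
  "('a::real_normed_field ^ 'n::finite \<Rightarrow> 'a) \<Rightarrow> ('a ^ 'n \<Rightarrow> 'a) \<Rightarrow> 'a ^ 'n \<Rightarrow> bool" where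
  "K_derivative f D x \<longleftrightarrow> (f has_derivative D) (at x) \<and> (\<forall>a v. D (a *s v) = a * D v)"

lemma K_derivative_const: "K_derivative (\<lambda>y. c) (\<lambda>v. 0) x"
  by (simp add: K_derivative_def)

lemma K_derivative_nth: "K_derivative (\<lambda>y. y $ i) (\<lambda>v. v $ i) x"
  by (simp add: K_derivative_def bounded_linear_imp_has_derivative bounded_linear_vec_nth)

lemma K_derivative_add:
  "K_derivative f D x \<Longrightarrow> K_derivative g D' x \<Longrightarrow> K_derivative (\<lambda>y. f y + g y) (\<lambda>v. D v + D' v) x"
  by (auto simp: K_derivative_def distrib_left intro: has_derivative_add)

lemma K_derivative_diff:
  "K_derivative f D x \<Longrightarrow> K_derivative g D' x \<Longrightarrow> K_derivative (\<lambda>y. f y - g y) (\<lambda>v. D v - D' v) x"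
  by (auto simp: K_derivative_def right_diff_distrib intro: has_derivative_diff)

lemma K_derivative_mult:
  "K_derivative f D x \<Longrightarrow> K_derivative g D' x
    \<Longrightarrow> K_derivative (\<lambda>y. f y * g y) (\<lambda>v. D v * g x + f x * D' v) x"
  using has_derivative_mult[of f D x UNIV g D'] by (auto simp: K_derivative_def algebra_simps)

lemma K_derivative_inverse:
  assumes "K_derivative f D x" "f x \<noteq> 0"
  shows "K_derivative (\<lambda>y. inverse (f y)) (\<lambda>v. - (inverse (f x) * D v * inverse (f x))) x"
  using assms unfolding K_derivative_def
  by (intro conjI allI Deriv.has_derivative_inverse) (simp_all add: algebra_simps)

lemma K_derivative_sum:
  "(\<And>i. i \<in> I \<Longrightarrow> K_derivative (f i) (D i) x)
    \<Longrightarrow> K_derivative (\<lambda>y. \<Sum>i\<in>I. f i y) (\<lambda>v. \<Sum>i\<in>I. D i v) x"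
  by (auto simp: K_derivative_def sum_distrib_left intro: has_derivative_sum)

lemma K_derivative_cong:
  assumes "K_derivative f D x" "open U" "x \<in> U" "\<And>y. y \<in> U \<Longrightarrow> g y = f y"
  shows "K_derivative g D x"
  using assms unfolding K_derivative_def by (metis has_derivative_transform_within_open)

lemma K_derivative_unique: "K_derivative f D x \<Longrightarrow> K_derivative f D' x \<Longrightarrow> D = D'"
  by (auto simp: K_derivative_def intro: has_derivative_unique)

lemma bounded_linear_axis: "bounded_linear (axis i :: 'a::real_normed_field \<Rightarrow> 'a ^ 'n::finite)"
proof (rule bounded_linear_intro[where K = 1])
  show "norm (axis i a :: 'a ^ 'n) \<le> norm a * 1" for a :: 'a
  proof -
    have "norm (axis i a :: 'a ^ 'n) \<le> (\<Sum>j\<in>UNIV. norm (axis i a $ j))"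
      unfolding norm_vec_def by (rule L2_set_le_sum) simp
    also have "\<dots> = norm a"
      by (simp add: axis_def if_distrib cong: if_cong)
    finally show ?thesis by simp
  qed
qed (auto simp: vec_eq_iff axis_def)

text \<open>Along a coordinate line, \<open>D\<close> is multiplication by
  \<open>D (axis i 1)\<close> because it is linear over the field; this makes it the field
  derivative that \<open>pd\<close> takes.\<close>

lemma K_derivative_pd:
  fixes f :: "'a::real_normed_field ^ 'n::finite \<Rightarrow> 'a"
  assumes "K_derivative f D x"
  shows "pd i f x = D (axis i 1)"
proof -
  have "((\<lambda>t. x + axis i t) has_derivative (\<lambda>t. axis i t)) (at 0)"
    using has_derivative_add[OF has_derivative_const bounded_linear_imp_has_derivative[OF bounded_linear_axis]]
    by fastforce
  moreover have x: "x + axis i 0 = x" by (simp add: vec_eq_iff axis_def)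
  have "(f has_derivative D) (at (x + axis i 0))"
    unfolding x using assms by (simp add: K_derivative_def)
  ultimately have "((\<lambda>t. f (x + axis i t)) has_derivative (\<lambda>t. D (axis i t))) (at 0)"
    by (rule has_derivative_compose)
  moreover have "(\<lambda>t. D (axis i t)) = (*) (D (axis i 1))"
  proof
    fix t
    have "axis i t = t *s (axis i 1 :: 'a ^ 'n)" by (simp add: vec_eq_iff axis_def)
    then have "D (axis i t) = t * D (axis i 1)" using assms by (simp only: K_derivative_def)
    then show "D (axis i t) = D (axis i 1) * t" by (simp only: mult.commute)
  qed
  ultimately have "((\<lambda>t. f (x + axis i t)) has_field_derivative D (axis i 1)) (at 0)"
    by (simp only: has_field_derivative_def)
  then show ?thesis by (simp add: pd_def DERIV_imp_deriv)
qed

lemma K_derivative_eq_sum_axis: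
  fixes f :: "'a::real_normed_field ^ 'n::finite \<Rightarrow> 'a"
  assumes "K_derivative f D x"
  shows "(\<Sum>i\<in>UNIV. v $ i * D (axis i 1)) = D v"
proof -
  have "linear D" using assms by (auto simp: K_derivative_def has_derivative_linear)
  have "D v = D (\<Sum>i\<in>UNIV. v $ i *s axis i 1)" by (simp add: basis_expansion)
  also have "\<dots> = (\<Sum>i\<in>UNIV. D (v $ i *s axis i 1))" by (rule linear_sum[OF \<open>linear D\<close>])
  finally show ?thesis using assms by (simp add: K_derivative_def)
qed

section \<open>Derivatives of maps into series and into vectors\<close>

text \<open>Differentiation is coefficientwise, so no topology on series enters; the product rule
  survives because each coefficient of a product is a finite sum.\<close>

definition fps_derivative ::
  "('a::real_normed_field ^ 'n::finite \<Rightarrow> 'a fps) \<Rightarrow> ('a ^ 'n \<Rightarrow> 'a fps) \<Rightarrow> 'a ^ 'n \<Rightarrow> bool" where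
  "fps_derivative G D x \<longleftrightarrow> (\<forall>p. K_derivative (\<lambda>y. fps_nth (G y) p) (\<lambda>v. fps_nth (D v) p) x)"

lemma fps_derivative_const: "fps_derivative (\<lambda>y. c) (\<lambda>v. 0) x"
  by (simp add: fps_derivative_def K_derivative_const)

lemma fps_derivative_mult:
  "fps_derivative G D x \<Longrightarrow> fps_derivative H D' x
    \<Longrightarrow> fps_derivative (\<lambda>y. G y * H y) (\<lambda>v. D v * H x + G x * D' v) x"
  by (auto simp: fps_derivative_def fps_mult_nth simp flip: sum.distrib
      intro!: K_derivative_sum K_derivative_mult)

lemma fps_derivative_cong:
  assumes "fps_derivative G D x" "open U" "x \<in> U" "\<And>y. y \<in> U \<Longrightarrow> H y = G y"
  shows "fps_derivative H D x"
  using assms K_derivative_cong unfolding fps_derivative_def by (metis (no_types, lifting))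

lemma fps_derivative_unique: "fps_derivative G D x \<Longrightarrow> fps_derivative G D' x \<Longrightarrow> D = D'"
  unfolding fps_derivative_def by (intro ext fps_ext) (metis (no_types, lifting) K_derivative_unique)

lemma fps_derivative_shift:
  "fps_derivative G D x \<Longrightarrow> fps_derivative (\<lambda>y. fps_shift k (G y)) (\<lambda>v. fps_shift k (D v)) x"
  by (simp add: fps_derivative_def)

definition vec_derivative ::
  "('a::real_normed_field ^ 'n::finite \<Rightarrow> 'a ^ 'n) \<Rightarrow> ('a ^ 'n \<Rightarrow> 'a ^ 'n) \<Rightarrow> 'a ^ 'n \<Rightarrow> bool" where
  "vec_derivative X D x \<longleftrightarrow> (\<forall>k. K_derivative (\<lambda>y. X y $ k) (\<lambda>v. D v $ k) x)"

lemma vec_derivative_const: "vec_derivative (\<lambda>y. c) (\<lambda>v. 0) x"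
  by (simp add: vec_derivative_def K_derivative_const)

lemma vec_derivative_ident: "vec_derivative (\<lambda>y. y) (\<lambda>v. v) x"
  by (simp add: vec_derivative_def K_derivative_nth)

lemma vec_derivative_cong:
  assumes "vec_derivative X D x" "open U" "x \<in> U" "\<And>y. y \<in> U \<Longrightarrow> Y y = X y"
  shows "vec_derivative Y D x"
  using assms K_derivative_cong unfolding vec_derivative_def by (metis (no_types, lifting))

lemma lie_eq:
  assumes "vec_derivative X DX x" "vec_derivative Y DY x"
  shows "lie X Y x = DY (X x) - DX (Y x)"
proof -
  have "(\<Sum>i\<in>UNIV. v $ i * pd i (\<lambda>y. Z y $ k) x) = D v $ k" if "vec_derivative Z D x" for Z D v k
    using that K_derivative_pd K_derivative_eq_sum_axis[of "\<lambda>y. Z y $ k" "\<lambda>v. D v $ k" x v]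
    unfolding vec_derivative_def by (metis (no_types, lifting) sum.cong)
  with assms show ?thesis
    by (simp add: vec_eq_iff lie_def sum_subtractf)
qed

lemma fps_derivative_ser:
  assumes "vec_derivative X D x"
  shows "fps_derivative (\<lambda>y. ser (X y)) (\<lambda>v. ser (D v)) x"
  unfolding fps_derivative_def
proof
  fix p
  show "K_derivative (\<lambda>y. fps_nth (ser (X y)) p) (\<lambda>v. fps_nth (ser (D v)) p) x"
  proof (cases "p < CARD('b)")
    case True
    then obtain k :: 'b where "pos k = p" by (rule obtain_pos)
    then show ?thesis using assms by (auto simp: vec_derivative_def)
  qed (simp add: ser_nth_beyond K_derivative_const)
qed

lemma vec_derivative_vec_of:
  "fps_derivative G D x \<Longrightarrow> vec_derivative (\<lambda>y. vec_of (G y)) (\<lambda>v. vec_of (D v)) x"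
  by (simp add: vec_derivative_def fps_derivative_def)

section \<open>The product and the Hertling--Manin identity\<close>

definition jprod :: "('a::comm_ring_1, 'n::{finite,linorder}) vec \<Rightarrow> ('a, 'n) vec \<Rightarrow> ('a, 'n) vec" where
  "jprod v w = vec_of (ser v * ser w)"

lemma vec_of_add: "vec_of (f + g :: 'a::comm_ring_1 fps) = vec_of f + vec_of g"
  by (simp add: vec_eq_iff)

lemma vec_of_diff: "vec_of (f - g :: 'a::comm_ring_1 fps) = vec_of f - vec_of g"
  by (simp add: vec_eq_iff)

lemma vec_of_mult_ser_vec_of:
  "(vec_of (f * ser (vec_of g :: 'a::comm_ring_1 ^ 'n::{finite,linorder})) :: ('a, 'n) vec) = vec_of (f * g)"
  using bform_ser_vec_of[of 0 1 0 f g] by (simp add: bform_def)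

lemma jprod_commute: "jprod v w = jprod w v"
  by (simp add: jprod_def mult.commute)

lemma jprod_assoc: "jprod (jprod v w) z = jprod v (jprod w z)"
proof -
  have "jprod (jprod v w) z = vec_of (ser z * (ser v * ser w))"
    by (simp add: jprod_def mult.commute[of _ "ser z"] vec_of_mult_ser_vec_of)
  also have "\<dots> = jprod v (jprod w z)"
    by (simp add: jprod_def vec_of_mult_ser_vec_of mult_ac)
  finally show ?thesis .
qed

lemma jprod_left_commute: "jprod v (jprod w z) = jprod w (jprod v z)"
  by (metis jprod_assoc jprod_commute)

lemmas jprod_ac = jprod_assoc jprod_commute jprod_left_commute

lemma jprod_add_right: "jprod v (w + z) = jprod v w + jprod v z"
  by (simp add: jprod_def ser_add distrib_left vec_of_add)

lemma jprod_diff_right: "jprod v (w - z) = jprod v w - jprod v z"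
  by (simp add: jprod_def ser_diff right_diff_distrib vec_of_diff)

lemma jprod_add_left: "jprod (w + z) v = jprod w v + jprod z v"
  by (simp add: jprod_commute[of _ v] jprod_add_right)

lemma jprod_diff_left: "jprod (w - z) v = jprod w v - jprod z v"
  by (simp add: jprod_commute[of _ v] jprod_diff_right)

lemma vec_derivative_jprod:
  assumes "vec_derivative X DX x" "vec_derivative Y DY x"
  shows "vec_derivative (\<lambda>y. jprod (X y) (Y y)) (\<lambda>v. jprod (DX v) (Y x) + jprod (X x) (DY v)) x"
  using vec_derivative_vec_of[OF fps_derivative_mult[OF fps_derivative_ser[OF assms(1)]
      fps_derivative_ser[OF assms(2)]]]
  by (simp add: jprod_def vec_of_add)

text \<open>The hypothesis on \<open>f\<close> holds for \<open>f = e\<close> with \<open>\<phi> = 0\<close> and for \<open>f = E\<^sup>-\<^sup>1\<close> with \<open>\<phi> = -E\<^sup>-\<^sup>2\<close>.\<close>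

lemma hertling_manin_conformal:
  fixes U :: "('a::real_normed_field, 'n::{finite,linorder}) vec set"
  assumes U: "open U" "x \<in> U"
    and c: "\<And>y v w. y \<in> U \<Longrightarrow> pmult (c y) v w = jprod (f y) (jprod v w)"
    and f: "vec_derivative f (\<lambda>v. jprod \<phi> v) x"
    and D: "vec_derivative X DX x" "vec_derivative Y DY x" "vec_derivative W DW x" "vec_derivative Z DZ x"
  shows "lie (vmult c X Y) (vmult c W Z) x
        - vmult c (lie (vmult c X Y) Z) W x
        - vmult c (lie (vmult c X Y) W) Z x
        - vmult c X (lie Y (vmult c Z W)) x
        + vmult c (vmult c X (lie Y Z)) W x
        + vmult c (vmult c X (lie Y W)) Z x
        - vmult c Y (lie X (vmult c Z W)) x
        + vmult c (vmult c Y (lie X Z)) W x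
        + vmult c (vmult c Y (lie X W)) Z x = 0"
proof -
  \<comment> \<open>The multiplication is \<open>f\<close> times a constant product: one term comes
    from differentiating \<open>f\<close>, two from the factors.\<close>
  have m: "vec_derivative (vmult c A B)
      (\<lambda>v. jprod (jprod \<phi> v) (jprod (A x) (B x)) + jprod (f x) (jprod (DA v) (B x) + jprod (A x) (DB v))) x"
    if "vec_derivative A DA x" "vec_derivative B DB x" for A B DA DB
    by (rule vec_derivative_cong[OF vec_derivative_jprod[OF f vec_derivative_jprod[OF that]] U])
      (simp add: vmult_def c)
  have v: "vmult c A B x = jprod (f x) (jprod (A x) (B x))" for A B
    by (simp add: vmult_def c U)
  note m1 = m[OF D(1,2)] and m2 = m[OF D(3,4)] and m3 = m[OF D(4,3)]
  note l = lie_eq[OF m1 m2] lie_eq[OF m1 D(4)] lie_eq[OF m1 D(3)] lie_eq[OF D(2) m3]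
    lie_eq[OF D(2,4)] lie_eq[OF D(2,3)] lie_eq[OF D(1) m3] lie_eq[OF D(1,4)] lie_eq[OF D(1,3)]
  show ?thesis
    \<comment> \<open>Once all brackets are expanded, the terms cancel by bilinearity, commutativity
      and associativity of \<open>jprod\<close> alone.\<close>
    unfolding v l
    by (simp add: jprod_add_left jprod_add_right jprod_diff_left jprod_diff_right jprod_ac)
qed

text \<open>The shapes required of the derivatives make the derivative of the form in direction i
  symmetric in i and its first argument, so the differentiated terms cancel. The quadratic terms
  cancel by \<open>bform_assoc_symmetric\<close>, whose hypothesis is \<open>rel\<close>.\<close>

lemma curvature_bform:
  fixes U :: "('a::real_normed_field, 'n::{finite,linorder}) vec set"
  assumes U: "open U" "x \<in> U"
    and \<Gamma>: "\<And>y k i j. y \<in> U \<Longrightarrow>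
          \<Gamma> y k i j = fps_nth (bform (\<gamma> y) (s y) (\<kappa> y) (fps_X ^ pos i) (fps_X ^ pos j)) (pos k)"
    and D: "fps_derivative \<gamma> (\<lambda>v. \<delta> * fps_shift 1 (ser v)) x"
      "fps_derivative s (\<lambda>v. \<sigma> * ser v) x"
      "K_derivative \<kappa> (\<lambda>v. \<rho> * fps_nth (ser v) 0) x"
    and rel: "\<gamma> x * (s x - fps_const (fps_nth (s x) 0)) = fps_X * s x * fps_const (\<kappa> x)"
  shows "curvature \<Gamma> x k l i j = 0"
proof -
  let ?b = "bform (\<gamma> x) (s x) (\<kappa> x)"
  let ?e = "\<lambda>i::'n. fps_X ^ pos i :: 'a fps"
  have pd: "pd i (\<lambda>y. \<Gamma> y k j l) x = fps_nth (fps_shift 1 (?e j) * fps_shift 1 (?e l) * fps_X * (\<delta> * fps_shift 1 (?e i))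
     + (\<sigma> * ?e i) * (?e j * ?e l)
     - fps_const ((\<rho> * fps_nth (?e i) 0) * (fps_nth (?e j) 0 * fps_nth (?e l) 0))) (pos k)" for i j
  proof -
    have "fps_derivative (\<lambda>y. (fps_shift 1 (?e j) * fps_shift 1 (?e l) * fps_X) * \<gamma> y)
      (\<lambda>v. (fps_shift 1 (?e j) * fps_shift 1 (?e l) * fps_X) * (\<delta> * fps_shift 1 (ser v))) x"
      using fps_derivative_mult[OF fps_derivative_const D(1)] by simp
    moreover have "fps_derivative (\<lambda>y. s y * (?e j * ?e l)) (\<lambda>v. (\<sigma> * ser v) * (?e j * ?e l)) x"
      using fps_derivative_mult[OF D(2) fps_derivative_const] by simp
    moreover have "fps_derivative (\<lambda>y. fps_const (\<kappa> y * (fps_nth (?e j) 0 * fps_nth (?e l) 0)))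
        (\<lambda>v. fps_const ((\<rho> * fps_nth (ser v) 0) * (fps_nth (?e j) 0 * fps_nth (?e l) 0))) x"
      unfolding fps_derivative_def
    proof
      fix p
      show "K_derivative (\<lambda>y. fps_nth (fps_const (\<kappa> y * (fps_nth (?e j) 0 * fps_nth (?e l) 0))) p)
          (\<lambda>v. fps_nth (fps_const ((\<rho> * fps_nth (ser v) 0) * (fps_nth (?e j) 0 * fps_nth (?e l) 0))) p) x"
        using K_derivative_mult[OF D(3) K_derivative_const, of "fps_nth (?e j) 0 * fps_nth (?e l) 0"]
        by (cases "p = 0") (simp_all only: fps_nth_fps_const simp_thms if_True if_False K_derivative_const
            mult_zero_right add_0_right)
    qed
    ultimately have "K_derivative (\<lambda>y. fps_nth ((fps_shift 1 (?e j) * fps_shift 1 (?e l) * fps_X) * \<gamma> y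
        + s y * (?e j * ?e l) - fps_const (\<kappa> y * (fps_nth (?e j) 0 * fps_nth (?e l) 0))) (pos k))
        (\<lambda>v. fps_nth ((fps_shift 1 (?e j) * fps_shift 1 (?e l) * fps_X) * (\<delta> * fps_shift 1 (ser v))
            + (\<sigma> * ser v) * (?e j * ?e l) - fps_const ((\<rho> * fps_nth (ser v) 0) *
            (fps_nth (?e j) 0 * fps_nth (?e l) 0))) (pos k)) x"
      unfolding fps_derivative_def fps_add_nth fps_sub_nth by (intro K_derivative_add K_derivative_diff) blast+
    then have "K_derivative (\<lambda>y. \<Gamma> y k j l)
        (\<lambda>v. fps_nth ((fps_shift 1 (?e j) * fps_shift 1 (?e l) * fps_X) * (\<delta> * fps_shift 1 (ser v))
            + (\<sigma> * ser v) * (?e j * ?e l) - fps_const ((\<rho> * fps_nth (ser v) 0) *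
            (fps_nth (?e j) 0 * fps_nth (?e l) 0))) (pos k)) x"
      by (rule K_derivative_cong[OF _ U]) (simp only: \<Gamma> bform_def mult_ac)
    from K_derivative_pd[OF this] show ?thesis
      by (simp only: ser_axis fps_const_1_eq_1 mult_1_left)
  qed
  \<comment> \<open>The contraction over m composes two forms, and the truncation between them does
    not matter.\<close>
  have quad: "(\<Sum>m\<in>UNIV. \<Gamma> x k i m * \<Gamma> x m j l) = fps_nth (?b (?e i) (?b (?e j) (?e l))) (pos k)" for i j
  proof -
    have "(\<Sum>m\<in>UNIV. \<Gamma> x k i m * \<Gamma> x m j l)
      = fps_nth (?b (?e i) (ser (vec_of (?b (?e j) (?e l)) :: ('a, 'n) vec))) (pos k)"
      by (simp add: bform_ser_right \<Gamma> U fps_sum_nth mult.commute)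
    also have "\<dots> = fps_nth (?b (?e i) (?b (?e j) (?e l))) (pos k)"
      using arg_cong[OF bform_ser_vec_of, of "\<lambda>v :: ('a, 'n) vec. v $ k"] by simp
    finally show ?thesis .
  qed
  show ?thesis
    unfolding curvature_def pd quad bform_assoc_symmetric[OF rel, of "?e i"]
    by (simp add: mult_ac)
qed

section \<open>Classes of regular functions\<close>

text \<open>The closure properties shared by smooth and holomorphic functions, so that the geometry
  is done once. \<open>class_cong\<close> reflects that only values on \<open>U\<close>
  matter.\<close>

locale function_class =
  fixes U :: "('a::real_normed_field, 'n::{finite,linorder}) vec set"
    and \<O> :: "(('a, 'n) vec \<Rightarrow> 'a) set"
  assumes open_domain: "open U"
    and class_cong: "\<And>f g. f \<in> \<O> \<Longrightarrow> (\<And>y. y \<in> U \<Longrightarrow> g y = f y) \<Longrightarrow> g \<in> \<O>"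
    and class_const: "\<And>c. (\<lambda>y. c) \<in> \<O>"
    and class_nth: "\<And>i. (\<lambda>y. y $ i) \<in> \<O>"
    and class_add: "\<And>f g. f \<in> \<O> \<Longrightarrow> g \<in> \<O> \<Longrightarrow> (\<lambda>y. f y + g y) \<in> \<O>"
    and class_mult: "\<And>f g. f \<in> \<O> \<Longrightarrow> g \<in> \<O> \<Longrightarrow> (\<lambda>y. f y * g y) \<in> \<O>"
    and class_inverse: "\<And>f. f \<in> \<O> \<Longrightarrow> (\<And>y. y \<in> U \<Longrightarrow> f y \<noteq> 0) \<Longrightarrow> (\<lambda>y. inverse (f y)) \<in> \<O>"
    and class_differentiable: "\<And>f x. f \<in> \<O> \<Longrightarrow> x \<in> U \<Longrightarrow> \<exists>D. K_derivative f D x"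
begin

lemma class_minus: "f \<in> \<O> \<Longrightarrow> (\<lambda>y. - f y) \<in> \<O>"
  using class_mult[OF class_const[of "-1"]] by simp

lemma class_diff: "f \<in> \<O> \<Longrightarrow> g \<in> \<O> \<Longrightarrow> (\<lambda>y. f y - g y) \<in> \<O>"
  using class_add[OF _ class_minus] by simp

lemma class_sum: "(\<And>i. i \<in> I \<Longrightarrow> f i \<in> \<O>) \<Longrightarrow> (\<lambda>y. \<Sum>i\<in>I. f i y) \<in> \<O>"
proof (induction I rule: infinite_finite_induct)
  case (insert i I) then show ?case by (simp add: class_add)
qed (simp_all add: class_const)

definition fps_class :: "(('a, 'n) vec \<Rightarrow> 'a fps) \<Rightarrow> bool" where
  "fps_class G \<longleftrightarrow> (\<forall>p. (\<lambda>y. fps_nth (G y) p) \<in> \<O>)"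

lemma fps_class_const: "fps_class (\<lambda>y. c)"
  by (simp add: fps_class_def class_const)

lemma fps_class_mult: "fps_class G \<Longrightarrow> fps_class H \<Longrightarrow> fps_class (\<lambda>y. G y * H y)"
  by (simp add: fps_class_def fps_mult_nth class_sum class_mult)

lemma fps_class_shift: "fps_class G \<Longrightarrow> fps_class (\<lambda>y. fps_shift k (G y))"
  by (simp add: fps_class_def)

lemma fps_class_ser: "fps_class (\<lambda>y. ser y)"
  unfolding fps_class_def
proof
  fix p
  show "(\<lambda>y :: ('a, 'n) vec. fps_nth (ser y) p) \<in> \<O>"
  proof (cases "p < CARD('n)")
    case True
    then obtain k :: 'n where "pos k = p" by (rule obtain_pos)
    then show ?thesis using class_nth[of k] by auto
  qed (simp add: ser_nth_beyond class_const)
qed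

text \<open>Strong induction along the recursion for the coefficients of a reciprocal, in which the
  only division is by the constant term.\<close>

lemma fps_class_inverse:
  assumes G: "fps_class G" and nz: "\<And>y. y \<in> U \<Longrightarrow> fps_nth (G y) 0 \<noteq> 0"
  shows "fps_class (\<lambda>y. inverse (G y))"
  unfolding fps_class_def
proof
  fix p
  show "(\<lambda>y. fps_nth (inverse (G y)) p) \<in> \<O>"
  proof (induction p rule: less_induct)
    case (less p)
    have i0: "(\<lambda>y. inverse (fps_nth (G y) 0)) \<in> \<O>"
      using G nz by (auto simp: fps_class_def intro: class_inverse)
    show ?case
    proof (cases p)
      case 0
      then show ?thesis using i0 by simp
    next
      case (Suc q)
      have "(\<lambda>y. - inverse (fps_nth (G y) 0) * (\<Sum>i = 1..p. fps_nth (G y) i * fps_nth (inverse (G y)) (p - i))) \<in> \<O>"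
        using G less by (intro class_mult class_minus i0 class_sum) (auto simp: fps_class_def)
      then show ?thesis
      proof (rule class_cong)
        show "fps_nth (inverse (G y)) p
          = - inverse (fps_nth (G y) 0) * (\<Sum>i = 1..p. fps_nth (G y) i * fps_nth (inverse (G y)) (p - i))" for y
          by (simp add: Suc fps_inverse_def)
      qed
    qed
  qed
qed

lemma fps_class_differentiable: "fps_class G \<Longrightarrow> x \<in> U \<Longrightarrow> \<exists>D. fps_derivative G D x"
proof -
  assume "fps_class G" "x \<in> U"
  then have "\<forall>p. \<exists>D. K_derivative (\<lambda>y. fps_nth (G y) p) D x"
    by (simp add: fps_class_def class_differentiable)
  then obtain D where "\<And>p. K_derivative (\<lambda>y. fps_nth (G y) p) (D p) x" by metis
  then have "fps_derivative G (\<lambda>v. Abs_fps (\<lambda>p. D p v)) x"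
    by (simp add: fps_derivative_def)
  then show ?thesis by blast
qed

text \<open>The reciprocal is already known to be differentiable, so its derivative is found by
  differentiating \<open>G y * inverse (G y) = 1\<close>.\<close>

lemma fps_derivative_inverse:
  assumes G: "fps_class G" and nz: "\<And>y. y \<in> U \<Longrightarrow> fps_nth (G y) 0 \<noteq> 0" and x: "x \<in> U"
    and D: "fps_derivative G D x"
  shows "fps_derivative (\<lambda>y. inverse (G y)) (\<lambda>v. - (inverse (G x))\<^sup>2 * D v) x"
proof -
  let ?i = "inverse (G x)"
  obtain D' where D': "fps_derivative (\<lambda>y. inverse (G y)) D' x"
    using fps_class_differentiable[OF fps_class_inverse[OF G nz] x] by blast
  have "fps_derivative (\<lambda>y. 1) (\<lambda>v. D v * ?i + G x * D' v) x"
    by (rule fps_derivative_cong[OF fps_derivative_mult[OF D D'] open_domain x])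
      (simp add: nz inverse_mult_eq_1')
  from fps_derivative_unique[OF this fps_derivative_const] have "D v * ?i + G x * D' v = 0" for v
    by meson
  moreover have "G x * ?i = 1" by (simp add: nz x inverse_mult_eq_1')
  ultimately have "D' v = - ?i\<^sup>2 * D v" for v
    by (metis (no_types, opaque_lifting) add.commute add_eq_0_iff mult.assoc mult.commute mult_1
        mult_minus_left power2_eq_square)
  then have "D' = (\<lambda>v. - ?i\<^sup>2 * D v)" by (rule ext)
  with D' show ?thesis by simp
qed

lemma vector_field_differentiable:
  assumes "X \<in> vector_fields \<O>" "x \<in> U"
  obtains D where "vec_derivative X D x"
proof -
  have "\<forall>k. \<exists>D. K_derivative (\<lambda>y. X y $ k) D x"
    using assms by (simp add: vector_fields_def class_differentiable)
  then obtain D where "\<And>k. K_derivative (\<lambda>y. X y $ k) (D k) x" by metis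
  then have "vec_derivative X (\<lambda>v. \<chi> k. D k v) x"
    by (simp add: vec_derivative_def)
  then show ?thesis by (rule that)
qed

lemma regular3_bform:
  assumes "\<And>y k i j. y \<in> U \<Longrightarrow>
          T y k i j = fps_nth (bform (\<gamma> y) (s y) (\<kappa> y) (fps_X ^ pos i) (fps_X ^ pos j)) (pos k)"
    and "fps_class \<gamma>" "fps_class s" "\<kappa> \<in> \<O>"
  shows "regular3 \<O> T"
  unfolding regular3_def
proof (intro allI)
  fix k i j :: 'n
  let ?e = "\<lambda>i::'n. fps_X ^ pos i :: 'a fps"
  have "(\<lambda>y. fps_nth (fps_X * fps_shift 1 (?e i) * fps_shift 1 (?e j) * \<gamma> y) (pos k)) \<in> \<O>"
    "(\<lambda>y. fps_nth (s y * ?e i * ?e j) (pos k)) \<in> \<O>"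
    using fps_class_mult[OF fps_class_const assms(2)] fps_class_mult[OF
        fps_class_mult[OF assms(3) fps_class_const] fps_class_const]
    unfolding fps_class_def by blast+
  moreover have "(\<lambda>y. fps_nth (fps_const (\<kappa> y * fps_nth (?e i) 0 * fps_nth (?e j) 0)) (pos k)) \<in> \<O>"
    using class_mult[OF class_mult[OF assms(4) class_const] class_const] class_const
    by (cases "pos k = 0") (simp_all only: fps_nth_fps_const simp_thms if_True if_False)
  ultimately show "(\<lambda>y. T y k i j) \<in> \<O>"
    by (intro class_cong[OF _ assms(1)]) (auto simp only: bform_def fps_add_nth fps_sub_nth intro: class_add class_diff)
qed

text \<open>Serves both products: commutativity and associativity are inherited from
  \<open>jprod\<close>, and regular fields have the pointwise derivatives that
  \<open>hertling_manin_conformal\<close> asks for.\<close>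

lemma F_manifold_conformal:
  assumes "regular3 \<O> c" "\<eta> \<in> vector_fields \<O>"
    and c: "\<And>y v w. y \<in> U \<Longrightarrow> pmult (c y) v w = jprod (f y) (jprod v w)"
    and f: "\<And>x. x \<in> U \<Longrightarrow> vec_derivative f (\<lambda>v. jprod (\<phi> x) v) x"
    and unit: "\<And>y v. y \<in> U \<Longrightarrow> jprod (f y) (jprod (\<eta> y) v) = v"
  shows "F_manifold \<O> U c \<eta>"
  unfolding F_manifold_def
proof (intro conjI ballI allI)
  fix X Y W Z x
  assume "X \<in> vector_fields \<O>" "Y \<in> vector_fields \<O>" "W \<in> vector_fields \<O>" "Z \<in> vector_fields \<O>"
    and x: "x \<in> U"
  then obtain DX DY DW DZ where "vec_derivative X DX x" "vec_derivative Y DY x"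
    "vec_derivative W DW x" "vec_derivative Z DZ x"
    by (metis vector_field_differentiable)
  from hertling_manin_conformal[OF open_domain x c f[OF x] this]
  show "lie (vmult c X Y) (vmult c W Z) x
        - vmult c (lie (vmult c X Y) Z) W x
        - vmult c (lie (vmult c X Y) W) Z x
        - vmult c X (lie Y (vmult c Z W)) x
        + vmult c (vmult c X (lie Y Z)) W x
        + vmult c (vmult c X (lie Y W)) Z x
        - vmult c Y (lie X (vmult c Z W)) x
        + vmult c (vmult c Y (lie X Z)) W x
        + vmult c (vmult c Y (lie X W)) Z x = 0" .
next
  show "pmult (c y) (\<eta> y) v = v" if "y \<in> U" for y v
    using that by (simp add: c unit)
qed (use assms(1,2) in \<open>simp_all add: c open_domain jprod_ac\<close>)

end

section \<open>Smooth and holomorphic functions\<close>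

text \<open>Recursion on the derivative taken first, which suits inductions with the product rule,
  whereas \<open>iter_pd\<close> recurses on the one taken last. Order 0 already demands
  differentiability.\<close>

primrec Ck :: "(real ^ 'n::finite) set \<Rightarrow> nat \<Rightarrow> (real ^ 'n \<Rightarrow> real) \<Rightarrow> bool" where
  "Ck U 0 f \<longleftrightarrow> (\<forall>x\<in>U. f differentiable (at x))"
| "Ck U (Suc k) f \<longleftrightarrow> (\<forall>x\<in>U. f differentiable (at x)) \<and> (\<forall>i. Ck U k (pd i f))"

lemma iter_pd_append: "iter_pd (is @ [i]) f = iter_pd is (pd i f)"
  by (induction "is") auto

lemma Ck_iff_iter_pd:
  "Ck U k f \<longleftrightarrow> (\<forall>is. length is \<le> k \<longrightarrow> (\<forall>x\<in>U. iter_pd is f differentiable (at x)))"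
proof (induction k arbitrary: f)
  case (Suc k)
  show ?case
  proof
    assume L: "Ck U (Suc k) f"
    show "\<forall>is. length is \<le> Suc k \<longrightarrow> (\<forall>x\<in>U. iter_pd is f differentiable (at x))"
    proof (intro allI impI)
      fix "is" :: "'a list" assume "length is \<le> Suc k"
      \<comment> \<open>The last list entry is the derivative taken first, hence the split at the
        end of the list.\<close>
      then show "\<forall>x\<in>U. iter_pd is f differentiable (at x)"
        using L by (cases "is" rule: rev_cases) (auto simp: Suc iter_pd_append simp del: iter_pd.simps(2))
    qed
  next
    assume R: "\<forall>is. length is \<le> Suc k \<longrightarrow> (\<forall>x\<in>U. iter_pd is f differentiable (at x))"
    have "\<forall>x\<in>U. iter_pd is (pd i f) differentiable (at x)" if "length is \<le> k" for i "is"
      using R[rule_format, of "is @ [i]"] that by (simp add: iter_pd_append)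
    then show "Ck U (Suc k) f"
      using R[rule_format, of "[]"] by (simp add: Suc)
  qed
qed simp

lemma smooth_iff_Ck: "f \<in> smooth_functions U \<longleftrightarrow> (\<forall>k. Ck U k f)"
  unfolding smooth_functions_def Ck_iff_iter_pd by blast

lemma differentiable_iff_K_derivative:
  fixes f :: "real ^ 'n::finite \<Rightarrow> real"
  shows "f differentiable (at x) \<longleftrightarrow> (\<exists>D. K_derivative f D x)"
proof -
  have "D (a *s v) = a * D v" if "(f has_derivative D) (at x)" for D a v
    using linear_cmul[OF has_derivative_linear[OF that], of a v] by (simp add: scalar_mult_eq_scaleR)
  then show ?thesis unfolding differentiable_def K_derivative_def by blast
qed

lemma Ck_differentiable: "Ck U k f \<Longrightarrow> x \<in> U \<Longrightarrow> \<exists>D. K_derivative f D x"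
  by (cases k) (auto simp: differentiable_iff_K_derivative)

lemma Ck_Suc_imp: "Ck U (Suc k) f \<Longrightarrow> Ck U k f"
  by (simp add: Ck_iff_iter_pd)

text \<open>On an open set, functions that agree have the same derivative, so the agreement passes
  to partial derivatives and the induction continues.\<close>

lemma Ck_cong:
  assumes "open U" "Ck U k f" "\<And>y. y \<in> U \<Longrightarrow> g y = f y"
  shows "Ck U k g"
  using assms(2,3)
proof (induction k arbitrary: f g)
  case 0
  have "\<exists>D. K_derivative g D x" if "x \<in> U" for x
    using Ck_differentiable[OF 0(1) that] K_derivative_cong[where f = f and g = g, OF _ \<open>open U\<close> that 0(2)] by blast
  then show ?case by (simp add: differentiable_iff_K_derivative)
next
  case (Suc k)
  have "\<exists>D. K_derivative f D x \<and> K_derivative g D x" if "x \<in> U" for x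
    using Ck_differentiable[OF Suc.prems(1) that] K_derivative_cong[where f = f and g
        = g, OF _ \<open>open U\<close> that Suc.prems(2)] by blast
  then have d: "\<forall>x\<in>U. g differentiable (at x)" "\<And>i y. y \<in> U \<Longrightarrow> pd i g y = pd i f y"
    unfolding differentiable_iff_K_derivative by (blast, metis K_derivative_pd)
  have "Ck U k (pd i g)" for i by (rule Suc.IH[OF _ d(2)]) (use Suc.prems in auto)
  with d(1) show ?case by simp
qed

lemma Ck_SucI:
  assumes "open U" "\<And>x. x \<in> U \<Longrightarrow> K_derivative f (D x) x" "\<And>i. Ck U k (\<lambda>x. D x (axis i 1))"
  shows "Ck U (Suc k) f"
  using assms Ck_cong[OF \<open>open U\<close> assms(3), of "pd _ f"] K_derivative_pd[OF assms(2)]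
  by (auto simp: differentiable_iff_K_derivative)

lemma Ck_const: "open U \<Longrightarrow> Ck U k (\<lambda>y. c)"
proof (induction k arbitrary: c)
  case 0 then show ?case by simp
next
  case (Suc k) then show ?case by (intro Ck_SucI[OF _ K_derivative_const]) auto
qed

lemma Ck_nth: "open U \<Longrightarrow> Ck U k (\<lambda>y. y $ i)"
proof (cases k)
  case (Suc m)
  assume "open U"
  then show ?thesis unfolding Suc by (intro Ck_SucI[OF _ K_derivative_nth] Ck_const)
qed (auto simp: differentiable_iff_K_derivative intro: K_derivative_nth)

lemma Ck_add: "open U \<Longrightarrow> Ck U k f \<Longrightarrow> Ck U k g \<Longrightarrow> Ck U k (\<lambda>y. f y + g y)"
proof (induction k arbitrary: f g)
  case 0 then show ?case by simp
next
  case (Suc k)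
  have "pd i (\<lambda>y. f y + g y) y = pd i f y + pd i g y" if y: "y \<in> U" for i y
  proof -
    obtain Df Dg where D: "K_derivative f Df y" "K_derivative g Dg y"
      using Ck_differentiable[OF Suc.prems(2) y] Ck_differentiable[OF Suc.prems(3) y] by blast
    show ?thesis using K_derivative_pd[OF K_derivative_add[OF D]] K_derivative_pd[OF D(1)]
        K_derivative_pd[OF D(2)] by simp
  qed
  moreover have "Ck U k (\<lambda>y. pd i f y + pd i g y)" for i
    using Suc.prems by (intro Suc.IH) auto
  ultimately have "Ck U k (pd i (\<lambda>y. f y + g y))" for i
    using Ck_cong[OF \<open>open U\<close>] by blast
  then show ?case using Suc.prems by auto
qed

text \<open>The Leibniz rule expresses a partial derivative by products of functions of order k, to
  which the induction hypothesis applies.\<close>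

lemma Ck_mult: "open U \<Longrightarrow> Ck U k f \<Longrightarrow> Ck U k g \<Longrightarrow> Ck U k (\<lambda>y. f y * g y)"
proof (induction k arbitrary: f g)
  case 0 then show ?case by simp
next
  case (Suc k)
  have "pd i (\<lambda>y. f y * g y) y = pd i f y * g y + f y * pd i g y" if y: "y \<in> U" for i y
  proof -
    obtain Df Dg where D: "K_derivative f Df y" "K_derivative g Dg y"
      using Ck_differentiable[OF Suc.prems(2) y] Ck_differentiable[OF Suc.prems(3) y] by blast
    show ?thesis using K_derivative_pd[OF K_derivative_mult[OF D]] K_derivative_pd[OF D(1)]
        K_derivative_pd[OF D(2)] by simp
  qed
  moreover have "Ck U k f" "Ck U k g" "Ck U k (pd i f)" "Ck U k (pd i g)" for i
    using Suc.prems Ck_Suc_imp by auto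
  then have "Ck U k (\<lambda>y. pd i f y * g y + f y * pd i g y)" for i
    using Suc by (auto intro!: Ck_add)
  ultimately have "Ck U k (pd i (\<lambda>y. f y * g y))" for i
    using Ck_cong[OF \<open>open U\<close>] by blast
  then show ?case using Suc.prems by auto
qed

text \<open>The derivative of 1/f contains 1/f again, but only to order k, where the induction
  hypothesis supplies it.\<close>

lemma Ck_inverse:
  assumes "open U" "Ck U k f" "\<And>y. y \<in> U \<Longrightarrow> f y \<noteq> 0"
  shows "Ck U k (\<lambda>y. inverse (f y))"
  using assms(2)
proof (induction k)
  case 0
  then show ?case using assms(3) by (auto intro!: differentiable_inverse)
next
  case (Suc k)
  have "pd i (\<lambda>y. inverse (f y)) y = (- 1) * (inverse (f y) * pd i f y * inverse (f y))" if y: "y \<in> U" for i y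
  proof -
    obtain D where D: "K_derivative f D y" using Ck_differentiable[OF Suc.prems y] by blast
    show ?thesis using K_derivative_pd[OF K_derivative_inverse[OF D assms(3)[OF y]]] K_derivative_pd[OF D] by simp
  qed
  moreover have "Ck U k (pd i f)" "Ck U k (\<lambda>y. inverse (f y))" for i
    using Suc Ck_Suc_imp by auto
  then have "Ck U k (\<lambda>y. (- 1) * (inverse (f y) * pd i f y * inverse (f y)))" for i
    using \<open>open U\<close> by (intro Ck_mult Ck_const)
  ultimately have "Ck U k (pd i (\<lambda>y. inverse (f y)))" for i
    using Ck_cong[OF \<open>open U\<close>] by blast
  moreover have "\<exists>D. K_derivative (\<lambda>y. inverse (f y)) D y" if "y \<in> U" for y
    using Ck_differentiable[OF Suc.prems that] K_derivative_inverse assms(3)[OF that] by blast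
  ultimately show ?case by (auto simp: differentiable_iff_K_derivative)
qed

lemma function_class_smooth:
  fixes U :: "(real, 'n::{finite,linorder}) vec set"
  assumes "open U"
  shows "function_class U (smooth_functions U)"
  by unfold_locales
    (use assms in \<open>auto simp: smooth_iff_Ck intro: Ck_cong Ck_const Ck_nth Ck_add Ck_mult Ck_inverse Ck_differentiable\<close>)

lemma holomorphic_iff_K_derivative: "f \<in> holomorphic_functions U \<longleftrightarrow> (\<forall>x\<in>U. \<exists>D. K_derivative f D x)"
  by (simp add: holomorphic_functions_def K_derivative_def)

lemma function_class_holomorphic:
  fixes U :: "(complex, 'n::{finite,linorder}) vec set"
  assumes "open U"
  shows "function_class U (holomorphic_functions U)"
proof
  show "g \<in> holomorphic_functions U" if "f \<in> holomorphic_functions U" "\<And>y. y \<in> U \<Longrightarrow> g y = f y" for f g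
    using that K_derivative_cong[OF _ assms] unfolding holomorphic_iff_K_derivative by metis
next
  show "(\<lambda>y. f y + g y) \<in> holomorphic_functions U" "(\<lambda>y. f y * g y) \<in> holomorphic_functions U"
    if "f \<in> holomorphic_functions U" "g \<in> holomorphic_functions U" for f g
    using that K_derivative_add K_derivative_mult unfolding holomorphic_iff_K_derivative by blast+
next
  show "(\<lambda>y. inverse (f y)) \<in> holomorphic_functions U"
    if "f \<in> holomorphic_functions U" "\<And>y. y \<in> U \<Longrightarrow> f y \<noteq> 0" for f
    using that K_derivative_inverse unfolding holomorphic_iff_K_derivative by blast
qed (use assms in \<open>auto simp: holomorphic_iff_K_derivative intro: K_derivative_const K_derivative_nth\<close>)

section \<open>The Jordan block structure is bi-flat\<close>

lemma jordan_domain_iff: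
  "u \<in> jordan_domain \<longleftrightarrow> fps_nth (ser u) 0 \<noteq> 0 \<and> fps_nth (ser u) 1 \<noteq> 0"
  by (simp add: jordan_domain_def coord_ser)

lemma open_jordan_domain: "open (jordan_domain :: ('a::real_normed_field, 'n::{finite,linorder}) vec set)"
proof -
  have "continuous_on UNIV (\<lambda>u :: ('a, 'n) vec. fps_nth (ser u) p)" for p
  proof (cases "p < CARD('n)")
    case True
    then obtain k :: 'n where "pos k = p" by (rule obtain_pos)
    then show ?thesis using linear_continuous_on[OF bounded_linear_vec_nth] by auto
  qed (simp add: ser_nth_beyond)
  then have "open {u :: ('a, 'n) vec. fps_nth (ser u) p \<noteq> 0}" for p
    by (intro open_Collect_neq continuous_on_const)
  moreover have "jordan_domain = {u :: ('a, 'n) vec. fps_nth (ser u) 0 \<noteq> 0} \<inter> {u. fps_nth (ser u) 1 \<noteq> 0}"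
    by (auto simp: jordan_domain_iff)
  ultimately show ?thesis by (metis open_Int)
qed

lemma jordan_c_bform: "jordan_c u k i j = fps_nth (bform 0 1 0 (fps_X ^ pos i) (fps_X ^ pos j)) (pos k)"
  by (auto simp: jordan_c_def idx_eq_pos bform_def simp flip: power_add)

lemma pmult_jordan_c: "pmult (jordan_c u) v w = jprod v w"
  by (subst pmult_bform[OF jordan_c_bform]) (simp add: bform_def jprod_def)

lemma ser_vec_of_1: "ser (vec_of 1 :: 'a::comm_ring_1 ^ 'n::{finite,linorder}) = 1"
  by (rule ser_eqI) (auto intro: less_le_trans[OF zero_less_card_finite])

lemma jordan_e_eq: "jordan_e u = vec_of 1"
  by (auto simp: jordan_e_def vec_eq_iff idx_eq_pos)

lemma jprod_e: "jprod (vec_of 1) v = v"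
  by (simp add: jprod_def ser_vec_of_1)

section \<open>The inverse of E\<close>

definition inv_E :: "('a::real_normed_field, 'n::{finite,linorder}) vec \<Rightarrow> ('a, 'n) vec" where
  "inv_E u = vec_of (inverse (ser u))"

lemma jprod_inv_E:
  assumes "fps_nth (ser u) 0 \<noteq> 0"
  shows "jprod (inv_E u) u = vec_of 1"
  using assms by (simp add: jprod_def inv_E_def mult.commute[of _ "ser u"] vec_of_mult_ser_vec_of inverse_mult_eq_1')

lemma jprod_inv_E_cancel:
  assumes "fps_nth (ser u) 0 \<noteq> 0"
  shows "jprod (inv_E u) (jprod u v) = v" "jprod u (jprod (inv_E u) v) = v"
proof -
  show "jprod (inv_E u) (jprod u v) = v"
    by (simp only: jprod_assoc[symmetric] jprod_inv_E[OF assms] jprod_e)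
  then show "jprod u (jprod (inv_E u) v) = v"
    by (simp only: jprod_left_commute[of u])
qed

text \<open>Multiplying \<open>jprod v u = vec_of 1\<close> by \<open>inv_E u\<close> shows that the
  solution is unique, which evaluates the definite description.\<close>

lemma jordan_E_inv_eq:
  assumes "fps_nth (ser u) 0 \<noteq> 0"
  shows "jordan_E_inv u = inv_E u"
  unfolding jordan_E_inv_def vinverse_def pmult_jordan_c jordan_E_def jordan_e_eq
proof (rule the_equality)
  show "jprod (inv_E u) u = vec_of 1" by (rule jprod_inv_E[OF assms])
  fix v assume "jprod v u = vec_of 1"
  then show "v = inv_E u"
    by (metis assms jprod_inv_E_cancel(1) jprod_commute jprod_e)
qed

section \<open>Symbols of the Jordan block structure as bilinear forms\<close>

definition gamma22_series :: "'a::real_normed_field \<Rightarrow> ('a, 'n::{finite,linorder}) vec \<Rightarrow> 'a fps" where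
  "gamma22_series \<epsilon> u = - (fps_const \<epsilon> * inverse (fps_shift 1 (ser u)))"

text \<open>Up to the factor \<open>-\<epsilon>\<close>, the recursion is the one for the reciprocal
  of the series with coefficients u^2, u^3, and so on. The offset is 2 because the symbols start at
  p = 2.\<close>

lemma gamma22_eq: "gamma22 \<epsilon> u (p + 2) = fps_nth (gamma22_series \<epsilon> u) p"
proof (induction p rule: less_induct)
  case (less p)
  show ?case
  proof (cases p)
    case 0
    then show ?thesis by (subst gamma22.simps) (simp add: gamma22_series_def coord_ser field_simps)
  next
    case (Suc q)
    let ?r = "inverse (fps_shift 1 (ser u))"
    have "gamma22 \<epsilon> u (p + 2) = - (1 / coord u 2) * (\<Sum>s = 1..p. coord u (2 + int s) * gamma22 \<epsilon> u (p - s + 2))"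
      by (subst gamma22.simps) (simp add: Suc Suc_diff_le)
    also have "(\<Sum>s = 1..p. coord u (2 + int s) * gamma22 \<epsilon> u (p - s + 2))
        = (\<Sum>s = 1..p. fps_nth (ser u) (s + 1) * (- (\<epsilon> * fps_nth ?r (p - s))))"
      using less by (intro sum.cong) (auto simp: coord_ser nat_add_distrib gamma22_series_def)
    also have "\<dots> = - \<epsilon> * (\<Sum>s = 1..p. fps_nth (ser u) (s + 1) * fps_nth ?r (p - s))"
      by (simp only: sum_distrib_left) (simp add: mult_ac)
    also have "- (1 / coord u 2) * \<dots> = - \<epsilon> * (- inverse (fps_nth (ser u) 1)
        * (\<Sum>s = 1..p. fps_nth (ser u) (s + 1) * fps_nth ?r (p - s)))"
      by (simp add: coord_ser divide_inverse)
    also have "\<dots> = - \<epsilon> * fps_nth ?r p"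
      by (simp add: Suc fps_inverse_def)
    also have "\<dots> = fps_nth (gamma22_series \<epsilon> u) p"
      by (simp add: gamma22_series_def)
    finally show ?thesis .
  qed
qed

text \<open>A first index is the monomial 1, whose shift is 0. Otherwise the form is X^(pos i + pos
  j - 1) times the series, so the coefficient at \<open>pos k\<close> has series index k + 2 - i - j
  in one-based indices, that is, k + 4 - i - j for \<open>gamma22\<close>.\<close>

lemma jordan_gamma_bform:
  "jordan_gamma \<epsilon> u k i j = fps_nth (bform (gamma22_series \<epsilon> u) 0 0 (fps_X ^ pos i) (fps_X ^ pos j)) (pos k)"
proof (cases "pos i = 0 \<or> pos j = 0")
  case True
  then show ?thesis by (auto simp: jordan_gamma_def bform_def idx_eq_pos fps_shift_one)
next
  case False
  then obtain p q where p: "pos i = Suc p" and q: "pos j = Suc q" by (metis not0_implies_Suc)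
  have sh: "fps_shift 1 (fps_X ^ Suc m :: 'a fps) = fps_X ^ m" for m
    by (simp add: fps_shift_one_X_mult[unfolded One_nat_def])
  have b: "bform (gamma22_series \<epsilon> u) 0 0 (fps_X ^ Suc p) (fps_X ^ Suc q) = fps_X ^ Suc (p + q) * gamma22_series \<epsilon> u"
    unfolding bform_def sh by (simp add: power_add mult_ac)
  show ?thesis
  proof (cases "pos k < Suc (p + q)")
    case True
    then show ?thesis by (simp add: b fps_X_power_mult_nth jordan_gamma_def idx_eq_pos p q del: power_Suc)
  next
    case ge: False
    then have "nat (idx k + 4 - idx i - idx j) = (pos k - Suc (p + q)) + 2"
      by (simp add: idx_eq_pos p q nat_eq_iff of_nat_diff)
    moreover have "idx i \<noteq> 1" "idx j \<noteq> 1" "idx k - idx i - idx j \<ge> -2"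
      using ge by (simp_all add: idx_eq_pos p q)
    ultimately have "jordan_gamma \<epsilon> u k i j = fps_nth (gamma22_series \<epsilon> u) (pos k - Suc (p + q))"
      by (simp only: jordan_gamma_def simp_thms if_True if_False gamma22_eq)
    with ge show ?thesis
      by (simp add: b fps_X_power_mult_nth p q del: power_Suc)
  qed
qed

text \<open>Since \<open>idx\<close> is \<open>pos\<close> plus one, the component in question has
  exponent pos k - pos i - pos j. A negative exponent gives 0 on both sides.\<close>

lemma coord_vec_of_power:
  "coord (vec_of f :: ('a::comm_ring_1, 'n::{finite,linorder}) vec) (idx k - idx i - idx j + 2)
     = fps_nth (f * fps_X ^ pos i * fps_X ^ pos j) (pos (k :: 'n))"
proof (cases "pos k < pos i + pos j")
  case True
  then show ?thesis
    by (simp add: coord_eq_0 idx_eq_pos mult.assoc fps_X_power_mult_right_nth flip: power_add)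
next
  case False
  have "nat (idx k - idx i - idx j + 2 - 1) = pos k - (pos i + pos j)"
    using False by (simp add: idx_eq_pos nat_eq_iff of_nat_diff)
  moreover have "pos k - (pos i + pos j) < CARD('n)" using pos_less[of k] by linarith
  ultimately show ?thesis
    using False by (simp add: coord_ser idx_eq_pos ser_nth_vec_of mult.assoc fps_X_power_mult_right_nth flip: power_add)
qed

lemma jordan_dual_c_bform:
  assumes "fps_nth (ser u) 0 \<noteq> 0"
  shows "jordan_dual_c u k i j = fps_nth (bform 0 (inverse (ser u)) 0 (fps_X ^ pos i) (fps_X ^ pos j)) (pos k)"
proof -
  have "2 + idx k - idx i - idx j = idx k - idx i - idx j + 2" by simp
  then show ?thesis
    by (simp only: jordan_dual_c_def jordan_E_inv_eq[OF assms] inv_E_def coord_vec_of_power)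
      (simp add: bform_def)
qed

lemma pmult_jordan_dual_c:
  assumes "fps_nth (ser u) 0 \<noteq> 0"
  shows "pmult (jordan_dual_c u) v w = jprod (inv_E u) (jprod v w)"
proof -
  have "pmult (jordan_dual_c u) v w = vec_of ((ser v * ser w) * inverse (ser u))"
    using pmult_bform[OF jordan_dual_c_bform[OF assms], of v w] by (simp add: bform_def mult_ac)
  also have "\<dots> = jprod (jprod v w) (inv_E u)"
    unfolding jprod_def inv_E_def vec_of_mult_ser_vec_of
    by (subst (1 2) mult.commute) (simp only: vec_of_mult_ser_vec_of)
  finally show ?thesis by (simp add: jprod_commute)
qed

text \<open>The summand with E^-1 is multiplication by \<open>\<epsilon> - 1\<close> times 1/u; the
  correction at k = i = j = 1 sees only constant terms, which is the role of
  \<open>\<kappa>\<close>.\<close>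

lemma jordan_dual_gamma_bform:
  assumes "fps_nth (ser u) 0 \<noteq> 0"
  shows "jordan_dual_gamma \<epsilon> u k i j = fps_nth (bform (gamma22_series \<epsilon> u) (fps_const (\<epsilon> - 1) * inverse (ser u))
      (\<epsilon> * inverse (fps_nth (ser u) 0)) (fps_X ^ pos i) (fps_X ^ pos j)) (pos k)"
proof -
  have "coord (inv_E u) 1 = inverse (fps_nth (ser u) 0)"
    by (simp add: coord_ser inv_E_def ser_nth_vec_of)
  moreover have "(\<epsilon> - 1) * coord (inv_E u) (idx k - idx i - idx j + 2)
      = fps_nth (fps_const (\<epsilon> - 1) * inverse (ser u) * fps_X ^ pos i * fps_X ^ pos j) (pos k)"
    by (simp add: inv_E_def coord_vec_of_power mult.assoc)
  ultimately show ?thesis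
    unfolding jordan_dual_gamma_def jordan_E_inv_eq[OF assms]
    by (auto simp: jordan_gamma_bform bform_def idx_eq_pos)
qed

text \<open>Passing from a connection to its pencil changes only s, so one curvature computation
  covers all parameters.\<close>

lemma bform_pencil:
  "fps_nth (bform \<gamma> s \<kappa> f g) p - l * fps_nth (bform 0 t 0 f g) p = fps_nth (bform \<gamma> (s - fps_const l * t) \<kappa> f g) p"
proof -
  have "bform \<gamma> (s - fps_const l * t) \<kappa> f g = bform \<gamma> s \<kappa> f g - fps_const l * bform 0 t 0 f g"
    by (simp add: bform_def algebra_simps)
  then show ?thesis by simp
qed

lemma sum_bform_nth:
  fixes w :: "('a::comm_ring_1, 'n::{finite,linorder}) vec"
  assumes "\<And>k i j. \<Gamma> k i j = fps_nth (bform \<gamma> s \<kappa> (fps_X ^ pos i) (fps_X ^ pos j)) (pos k)"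
  shows "(\<Sum>m\<in>UNIV. \<Gamma> k j m * w $ m) = fps_nth (bform \<gamma> s \<kappa> (fps_X ^ pos j) (ser w)) (pos k)"
  by (simp add: assms bform_ser_right fps_sum_nth mult.commute)

lemma mult_op_jordan_c: "mult_op jordan_c X u i k = jprod (X u) (axis k 1) $ i"
proof -
  have "mult_op jordan_c X u i k = (\<Sum>j\<in>UNIV. jordan_c u i k j * X u $ j)"
    unfolding mult_op_def jordan_c_bform by (simp add: bform_commute[of _ _ _ "fps_X ^ pos k"])
  also have "\<dots> = jprod (X u) (axis k 1) $ i"
    by (subst sum_bform_nth[OF jordan_c_bform]) (simp add: bform_def jprod_def ser_axis mult.commute)
  finally show ?thesis .
qed

lemma ser_nonzero: "u \<in> jordan_domain \<Longrightarrow> fps_nth (ser u) 0 \<noteq> 0"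
  by (simp add: jordan_domain_iff)

lemma shift_nonzero: "u \<in> jordan_domain \<Longrightarrow> fps_nth (fps_shift 1 (ser u)) 0 \<noteq> 0"
  by (simp add: jordan_domain_iff)

section \<open>Regularity of the series and flatness of the two pencils\<close>

locale jordan_class = function_class jordan_domain \<O>
  for \<O> :: "(('a::real_normed_field, 'n::{finite,linorder}) vec \<Rightarrow> 'a) set" +
  fixes \<epsilon> :: 'a
begin

lemma fps_class_gamma22_series: "fps_class (gamma22_series \<epsilon>)"
proof -
  have "gamma22_series \<epsilon> = (\<lambda>u :: ('a, 'n) vec. - fps_const \<epsilon> * inverse (fps_shift 1 (ser u)))"
    by (intro ext) (simp only: gamma22_series_def mult_minus_left)
  then show ?thesis
    using fps_class_mult[OF fps_class_const fps_class_inverse[OF fps_class_shift[OF fps_class_ser] shift_nonzero]]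
    by simp
qed

lemma fps_class_inverse_ser: "fps_class (\<lambda>u. inverse (ser u))"
  by (rule fps_class_inverse[OF fps_class_ser ser_nonzero])

lemma fps_derivative_inverse_ser:
  "(u :: ('a, 'n) vec) \<in> jordan_domain \<Longrightarrow> fps_derivative (\<lambda>u. inverse (ser u)) (\<lambda>v. - (inverse (ser u))\<^sup>2 * ser v) u"
  by (rule fps_derivative_inverse[OF fps_class_ser ser_nonzero _ fps_derivative_ser[OF vec_derivative_ident]])

lemma fps_derivative_gamma22_series:
  assumes "(u :: ('a, 'n) vec) \<in> jordan_domain"
  shows "fps_derivative (gamma22_series \<epsilon>)
     (\<lambda>v. (fps_const \<epsilon> * (inverse (fps_shift 1 (ser u)))\<^sup>2) * fps_shift 1 (ser v)) u"
proof -
  note D = fps_derivative_mult[OF fps_derivative_const[of "- fps_const \<epsilon>"]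
      fps_derivative_inverse[OF fps_class_shift[OF fps_class_ser] shift_nonzero assms
        fps_derivative_shift[OF fps_derivative_ser[OF vec_derivative_ident]]]]
  have "gamma22_series \<epsilon> = (\<lambda>u :: ('a, 'n) vec. - fps_const \<epsilon> * inverse (fps_shift 1 (ser u)))"
    by (intro ext) (simp only: gamma22_series_def mult_minus_left)
  moreover have "0 * inverse (fps_shift 1 (ser u)) + - fps_const \<epsilon> * (- (inverse (fps_shift 1 (ser u)))\<^sup>2 * f)
      = fps_const \<epsilon> * (inverse (fps_shift 1 (ser u)))\<^sup>2 * f" for f
    by algebra
  ultimately show ?thesis using D by (simp only:)
qed

text \<open>Here s is a constant series and \<open>\<kappa>\<close> is 0, so both sides of the
  relation between \<open>\<gamma>\<close>, s and \<open>\<kappa>\<close> vanish.\<close>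

lemma flat_on_jordan_gamma: "flat_on jordan_domain (\<lambda>x k i j. jordan_gamma \<epsilon> x k i j
    - l * jordan_c (x :: ('a, 'n) vec) k i j)"
  unfolding flat_on_def
proof (intro ballI allI)
  fix u :: "('a, 'n) vec" and k i j m :: 'n
  assume u: "u \<in> jordan_domain"
  show "curvature (\<lambda>x k i j. jordan_gamma \<epsilon> x k i j - l * jordan_c x k i j) u k m i j = 0"
  proof (rule curvature_bform[OF open_domain u, where \<gamma> = "gamma22_series \<epsilon>" and s = "\<lambda>_. - fps_const l"
        and \<kappa> = "\<lambda>_. 0" and \<sigma> = 0 and \<rho> = 0])
    show "fps_derivative (gamma22_series \<epsilon>) (\<lambda>v. (fps_const \<epsilon> * (inverse
        (fps_shift 1 (ser u)))\<^sup>2) * fps_shift 1 (ser v)) u"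
      by (rule fps_derivative_gamma22_series[OF u])
  qed (simp_all add: jordan_gamma_bform jordan_c_bform bform_pencil fps_derivative_const K_derivative_const
      flip: fps_const_neg)
qed

text \<open>The required relation follows from 1/u - 1/u_0 = -X u'/(u u_0): the factor u' cancels
  against the denominator of \<open>gamma22_series\<close>.\<close>

lemma flat_on_jordan_dual_gamma:
  "flat_on jordan_domain (\<lambda>x k i j. jordan_dual_gamma \<epsilon> x k i j - l * jordan_dual_c (x :: ('a, 'n) vec) k i j)"
  unfolding flat_on_def
proof (intro ballI allI)
  fix u :: "('a, 'n) vec" and k i j m :: 'n
  assume u: "u \<in> jordan_domain"
  let ?c = "fps_const (\<epsilon> - 1 - l)" and ?i = "inverse (ser u)"
  show "curvature (\<lambda>x k i j. jordan_dual_gamma \<epsilon> x k i j - l * jordan_dual_c x k i j) u k m i j = 0"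
  proof (rule curvature_bform[OF open_domain u, where \<gamma> = "gamma22_series \<epsilon>" and s = "\<lambda>u. ?c * inverse (ser u)"
        and \<kappa> = "\<lambda>u. \<epsilon> * inverse (fps_nth (ser u) 0)"
        and \<sigma> = "- ?c * ?i\<^sup>2" and \<rho> = "- \<epsilon> * (inverse (fps_nth (ser u) 0))\<^sup>2"])
    show "fps_derivative (gamma22_series \<epsilon>) (\<lambda>v. (fps_const \<epsilon> * (inverse
        (fps_shift 1 (ser u)))\<^sup>2) * fps_shift 1 (ser v)) u"
      by (rule fps_derivative_gamma22_series[OF u])
    show "fps_derivative (\<lambda>u. ?c * inverse (ser u)) (\<lambda>v. - ?c * ?i\<^sup>2 * ser v) u"
    proof -
      have "0 * ?i + ?c * (- ?i\<^sup>2 * f) = - ?c * ?i\<^sup>2 * f" for f by algebra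
      with fps_derivative_mult[OF fps_derivative_const fps_derivative_inverse_ser[OF u], of ?c]
      show ?thesis by (simp only:)
    qed
    have "K_derivative (\<lambda>u. fps_nth (ser u) 0) (\<lambda>v. fps_nth (ser v) 0) u"
      using fps_derivative_ser[OF vec_derivative_ident, unfolded fps_derivative_def] by blast
    from K_derivative_mult[OF K_derivative_const K_derivative_inverse[OF this ser_nonzero[OF u]], of \<epsilon>]
    show "K_derivative (\<lambda>u. \<epsilon> * inverse (fps_nth (ser u) 0))
       (\<lambda>v. - \<epsilon> * (inverse (fps_nth (ser u) 0))\<^sup>2 * fps_nth (ser v) 0) u"
      by (simp add: power2_eq_square mult_ac)
    show "jordan_dual_gamma \<epsilon> y k i j - l * jordan_dual_c y k i j =
       fps_nth (bform (gamma22_series \<epsilon> y) (?c * inverse (ser y)) (\<epsilon> * inverse (fps_nth (ser y) 0))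
         (fps_X ^ pos i) (fps_X ^ pos j)) (pos k)" if "y \<in> jordan_domain" for y :: "('a, 'n) vec" and k i j :: 'n
      unfolding jordan_dual_gamma_bform[OF ser_nonzero[OF that]] jordan_dual_c_bform[OF ser_nonzero[OF that]]
        bform_pencil left_diff_distrib[symmetric] fps_const_sub ..
    \<comment> \<open>The reciprocals are turned into polynomial equations, which reduces the
      relation to an ideal membership.\<close>
    define u0 u1 where "u0 = fps_nth (ser u) 0" "u1 = fps_shift 1 (ser u)"
    have u01: "ser u = fps_const u0 + fps_X * u1" unfolding u0_u1_def by (simp only: fps_decomp)
    have "ser u * ?i = 1" "fps_const u0 * fps_const (inverse u0) = 1" "u1 * inverse u1 = 1"
      using inverse_mult_eq_1'[OF ser_nonzero[OF u]] ser_nonzero[OF u] inverse_mult_eq_1'[OF shift_nonzero[OF u]]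
      by (simp_all add: u0_u1_def flip: fps_const_1_eq_1)
    moreover have "gamma22_series \<epsilon> u = - (fps_const \<epsilon> * inverse u1)" by (simp add: gamma22_series_def u0_u1_def)
    moreover have "fps_const (fps_nth (?c * ?i) 0) = ?c * fps_const (inverse u0)"
      "fps_const (\<epsilon> * inverse (fps_nth (ser u) 0)) = fps_const \<epsilon> * fps_const (inverse u0)"
      by (simp_all add: u0_u1_def)
    ultimately show "gamma22_series \<epsilon> u * (?c * ?i - fps_const (fps_nth (?c * ?i) 0)) =
       fps_X * (?c * ?i) * fps_const (\<epsilon> * inverse (fps_nth (ser u) 0))"
      using u01 by algebra
  qed
qed

section \<open>The two flat structures and their compatibility\<close>

lemma jordan_E_vector_field: "jordan_E \<in> vector_fields \<O>"
  by (simp add: vector_fields_def jordan_E_def class_nth)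

lemma jordan_e_vector_field: "jordan_e \<in> vector_fields \<O>"
  by (simp add: vector_fields_def jordan_e_eq class_const)

lemma flat_F_manifold_jordan: "flat_F_manifold \<O> jordan_domain (jordan_gamma \<epsilon>) jordan_c jordan_e"
  unfolding flat_F_manifold_def
proof (intro conjI ballI allI)
  show "F_manifold \<O> jordan_domain (jordan_c :: ('a, 'n) symbol3) jordan_e"
  proof (rule F_manifold_conformal[where f = "\<lambda>_. vec_of 1" and \<phi> = "\<lambda>_. 0"])
    show "regular3 \<O> (jordan_c :: ('a, 'n) symbol3)"
      by (rule regular3_bform[OF jordan_c_bform fps_class_const fps_class_const class_const])
    show "vec_derivative (\<lambda>_. vec_of 1) (jprod 0) x" for x :: "('a, 'n) vec"
    proof -
      have "jprod 0 = (\<lambda>v :: ('a, 'n) vec. 0)"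
        by (rule ext) (metis diff_self jprod_diff_left)
      then show ?thesis by (simp add: vec_derivative_const)
    qed
  qed (simp_all add: jordan_e_vector_field pmult_jordan_c jprod_e jordan_e_eq)
  show "regular3 \<O> (jordan_gamma \<epsilon>)"
    by (rule regular3_bform[OF jordan_gamma_bform fps_class_gamma22_series fps_class_const class_const])
  show "nabla_vector (jordan_gamma \<epsilon>) jordan_e x k j = 0" for x :: "('a, 'n) vec" and k j
  proof -
    have "pd j (\<lambda>y :: ('a, 'n) vec. jordan_e y $ k) x = 0"
      unfolding jordan_e_eq by (rule K_derivative_pd[OF K_derivative_const])
    then show ?thesis
      unfolding nabla_vector_def sum_bform_nth[OF jordan_gamma_bform]
      by (simp add: jordan_e_eq ser_vec_of_1 bform_def fps_shift_one)
  qed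
  show "torsionless_on jordan_domain (\<lambda>x k i j. jordan_gamma \<epsilon> x k i j - l * jordan_c (x :: ('a, 'n) vec) k i j)" for l
    unfolding torsionless_on_def jordan_gamma_bform jordan_c_bform by (simp add: bform_commute)
qed (rule flat_on_jordan_gamma)

text \<open>This is the covariant constancy of E: its coordinate derivative is the identity, so the
  connection must contribute -h. The three summands are \<open>-\<epsilon>\<close> (h - h_0),
  (\<open>\<epsilon>\<close> - 1) h and \<open>-\<epsilon>\<close> h_0.\<close>

lemma bform_dual_E:
  assumes "(u :: ('a, 'n) vec) \<in> jordan_domain"
  shows "bform (gamma22_series \<epsilon> u) (fps_const (\<epsilon> - 1) * inverse (ser u)) (\<epsilon> * inverse
      (fps_nth (ser u) 0)) h (ser u) = - h"
proof -
  define u1 where "u1 = fps_shift 1 (ser u)"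
  define h0 h1 where "h0 = fps_const (fps_nth h 0)" "h1 = fps_shift 1 h"
  have "inverse u1 * u1 = 1" "inverse (ser u) * ser u = 1"
    unfolding u1_def
    by (rule inverse_mult_eq_1[OF shift_nonzero[OF assms]], rule inverse_mult_eq_1[OF ser_nonzero[OF assms]])
  moreover have "fps_const (\<epsilon> * inverse (fps_nth (ser u) 0) * fps_nth h 0 * fps_nth (ser u) 0) = fps_const \<epsilon> * h0"
    by (simp add: h0_h1_def ser_nonzero assms)
  moreover have "h = h0 + fps_X * h1" unfolding h0_h1_def by (simp only: fps_decomp)
  moreover have "fps_const (\<epsilon> - 1) = fps_const \<epsilon> - 1" by (metis fps_const_sub fps_const_1_eq_1)
  ultimately show ?thesis
    unfolding bform_def gamma22_series_def u1_def[symmetric] h0_h1_def(2)[symmetric] by algebra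
qed

lemma flat_F_manifold_jordan_dual: "flat_F_manifold \<O> jordan_domain (jordan_dual_gamma \<epsilon>) jordan_dual_c jordan_E"
  unfolding flat_F_manifold_def
proof (intro conjI ballI allI)
  show "F_manifold \<O> jordan_domain (jordan_dual_c :: ('a, 'n) symbol3) jordan_E"
  proof (rule F_manifold_conformal[where f = inv_E and \<phi> = "\<lambda>u. vec_of (- (inverse (ser u))\<^sup>2)"])
    show "regular3 \<O> (jordan_dual_c :: ('a, 'n) symbol3)"
      by (rule regular3_bform[OF jordan_dual_c_bform[OF ser_nonzero] fps_class_const fps_class_inverse_ser class_const])
    show "vec_derivative inv_E (jprod (vec_of (- (inverse (ser x))\<^sup>2))) x" if "x \<in> jordan_domain"
        for x :: "('a, 'n) vec"
    proof -
      have "jprod (vec_of (- (inverse (ser x))\<^sup>2)) = (\<lambda>v :: ('a, 'n) vec. vec_of (- (inverse (ser x))\<^sup>2 * ser v))"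
        unfolding jprod_def by (subst (1 2) mult.commute) (rule ext, rule vec_of_mult_ser_vec_of)
      then show ?thesis
        using vec_derivative_vec_of[OF fps_derivative_inverse_ser[OF that]] by (simp only: inv_E_def[abs_def])
    qed
  qed (simp_all add: jordan_E_vector_field pmult_jordan_dual_c jprod_inv_E_cancel jordan_E_def ser_nonzero)
  have "(\<lambda>u :: ('a, 'n) vec. fps_nth (ser u) 0) \<in> \<O>"
    using fps_class_ser by (simp add: fps_class_def)
  then have "(\<lambda>u :: ('a, 'n) vec. \<epsilon> * inverse (fps_nth (ser u) 0)) \<in> \<O>"
    by (intro class_mult[OF class_const] class_inverse ser_nonzero)
  then show "regular3 \<O> (jordan_dual_gamma \<epsilon>)"
    by (intro regular3_bform[OF jordan_dual_gamma_bform[OF ser_nonzero] fps_class_gamma22_series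
          fps_class_mult[OF fps_class_const fps_class_inverse_ser]])
  show "nabla_vector (jordan_dual_gamma \<epsilon>) jordan_E x k j = 0" if "x \<in> jordan_domain" for x :: "('a, 'n) vec" and k j
  proof -
    have "pd j (\<lambda>y :: ('a, 'n) vec. jordan_E y $ k) x = axis j 1 $ k"
      unfolding jordan_E_def by (rule K_derivative_pd[OF K_derivative_nth])
    then show ?thesis
      unfolding nabla_vector_def sum_bform_nth[OF jordan_dual_gamma_bform[OF ser_nonzero[OF that]]]
      by (simp add: jordan_E_def bform_dual_E[OF that] axis_def eq_commute)
  qed
  show "torsionless_on jordan_domain (\<lambda>x k i j. jordan_dual_gamma \<epsilon> x k i j
      - l * jordan_dual_c (x :: ('a, 'n) vec) k i j)" for l
    unfolding torsionless_on_def
    by (simp add: jordan_dual_gamma_bform jordan_dual_c_bform ser_nonzero bform_commute)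
qed (rule flat_on_jordan_dual_gamma)

lemma vec_derivative_jprod_const: "vec_derivative (\<lambda>y. jprod y w) (\<lambda>v. jprod v w) (x :: ('a, 'n) vec)"
proof -
  have "jprod x 0 = 0" by (metis diff_self jprod_diff_right)
  then show ?thesis
    using vec_derivative_jprod[OF vec_derivative_ident vec_derivative_const, of w x] by simp
qed

text \<open>Antisymmetrising the derivative of a_0 leaves terms with constant parts of the two
  monomials; the connection produces the same terms with opposite sign, and everything else is
  symmetric.\<close>

lemma d_nabla_jordan_V:
  assumes u: "(u :: ('a, 'n) vec) \<in> jordan_domain"
  shows "d_nabla (jordan_gamma \<epsilon>) (jordan_V \<epsilon>) u i j k = 0"
proof -
  let ?e = "\<lambda>i::'n. fps_X ^ pos i :: 'a fps"
  let ?u0 = "fps_nth (ser u) 0"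
  have V: "jordan_V \<epsilon> y i k = jprod y (axis k 1) $ i - fps_nth (?e k) (pos i) * \<epsilon> * fps_nth (ser y) 0"
      for y :: "('a, 'n) vec" and i k
    by (simp add: jordan_V_def mult_op_jordan_c jordan_E_def coord_ser)
  have pd: "pd j (\<lambda>y. jordan_V \<epsilon> y i k) u = fps_nth (?e j * ?e k) (pos i)
      - fps_nth (?e k) (pos i) * \<epsilon> * fps_nth (?e j) 0" for j k
  proof -
    have "K_derivative (\<lambda>y. jordan_V \<epsilon> y i k)
      (\<lambda>v. jprod v (axis k 1) $ i - fps_nth (?e k) (pos i) * \<epsilon> * fps_nth (ser v) 0) u"
      unfolding V
    proof (rule K_derivative_diff)
      show "K_derivative (\<lambda>y. jprod y (axis k 1) $ i) (\<lambda>v. jprod v (axis k 1) $ i) u"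
        using vec_derivative_jprod_const[unfolded vec_derivative_def] by blast
      have "K_derivative (\<lambda>y. fps_nth (ser y) 0) (\<lambda>v. fps_nth (ser v) 0) u"
        using fps_derivative_ser[OF vec_derivative_ident, unfolded fps_derivative_def] by blast
      from K_derivative_mult[OF K_derivative_const this, of "fps_nth (?e k) (pos i) * \<epsilon>"]
      show "K_derivative (\<lambda>y. fps_nth (?e k) (pos i) * \<epsilon> * fps_nth (ser y) 0)
          (\<lambda>v. fps_nth (?e k) (pos i) * \<epsilon> * fps_nth (ser v) 0) u" by simp
    qed
    from K_derivative_pd[OF this] show ?thesis
      by (simp only: ser_axis jprod_def vec_of_nth fps_const_1_eq_1 mult_1_left)
  qed
  let ?b = "bform (gamma22_series \<epsilon> u) 0 0"
  have sum: "(\<Sum>m\<in>UNIV. jordan_gamma \<epsilon> u i j m * jordan_V \<epsilon> u m k)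
     = fps_nth (?b (?e j) (ser u * ?e k) - fps_const (\<epsilon> * ?u0) * ?b (?e j) (?e k)) (pos i)" for j k
  proof -
    have "jordan_V \<epsilon> u m k = (vec_of (ser u * ?e k) - (\<epsilon> * ?u0) *s axis k 1 :: ('a, 'n) vec) $ m" for m
      by (simp add: V jprod_def ser_axis) (simp add: axis_def)
    then have "(\<Sum>m\<in>UNIV. jordan_gamma \<epsilon> u i j m * jordan_V \<epsilon> u m k)
      = fps_nth (?b (?e j) (ser (vec_of (ser u * ?e k) - (\<epsilon> * ?u0) *s axis k 1 :: ('a, 'n) vec))) (pos i)"
      by (simp only: sum_bform_nth[OF jordan_gamma_bform])
    also have "?b (?e j) (ser (vec_of (ser u * ?e k) - (\<epsilon> * ?u0) *s axis k 1 :: ('a, 'n) vec))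
       = ?b (?e j) (ser (vec_of (ser u * ?e k) :: ('a, 'n) vec)) - fps_const (\<epsilon> * ?u0) * ?b (?e j) (?e k)"
      using bform_add_right[of "gamma22_series \<epsilon> u" 0 0 "?e j" "ser (vec_of (ser u * ?e k) :: ('a, 'n) vec)" "fps_const (- (\<epsilon> * ?u0)) * ?e k"]
      by (simp only: ser_diff ser_scale ser_axis fps_const_1_eq_1 mult_1_left bform_scale_right)
        (simp add: algebra_simps flip: fps_const_neg)
    also have "fps_nth \<dots> (pos i) = fps_nth (?b (?e j) (ser u * ?e k) - fps_const (\<epsilon> * ?u0) * ?b (?e j) (?e k)) (pos i)"
      using arg_cong[OF bform_ser_vec_of, of "\<lambda>v :: ('a, 'n) vec. v $ i" "gamma22_series \<epsilon> u" 0 0 "?e j" "ser u * ?e k"] by simp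
    finally show ?thesis .
  qed
  \<comment> \<open>Uses (u h)' = u' h + u_0 h' together with u' times \<open>gamma22_series\<close>
    being \<open>-\<epsilon>\<close>.\<close>
  have b: "?b f (ser u * h) = fps_const ?u0 * ?b f h - fps_const \<epsilon> * (f - fps_const (fps_nth f 0)) * h" for f h
  proof -
    define u0 u1 where u: "u0 = fps_const ?u0" "u1 = fps_shift 1 (ser u)"
    define f0 f1 where f: "f0 = fps_const (fps_nth f 0)" "f1 = fps_shift 1 f"
    define h0 h1 where h: "h0 = fps_const (fps_nth h 0)" "h1 = fps_shift 1 h"
    have d: "ser u = u0 + fps_X * u1" "f = f0 + fps_X * f1" "h = h0 + fps_X * h1"
      unfolding u f h by (simp_all only: fps_decomp)
    have "ser u * h = u0 * h0 + fps_X * (u1 * h + u0 * h1)"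
      by (subst d(1)) (subst (1) d(3), simp add: algebra_simps d(3))
    then have "fps_shift 1 (ser u * h) = u1 * h + u0 * h1"
      by (simp only: fps_shift_add fps_shift_one_X_mult u(1) h(1) fps_const_mult fps_shift_one_const add_0_left)
    moreover have "u1 * inverse u1 = 1"
      unfolding u by (rule inverse_mult_eq_1'[OF shift_nonzero[OF assms]])
    moreover have "gamma22_series \<epsilon> u = - (fps_const \<epsilon> * inverse u1)" by (simp add: gamma22_series_def u)
    ultimately show ?thesis
      using d(2) unfolding bform_def u(1)[symmetric] f(1)[symmetric] f(2)[symmetric] h(2)[symmetric]
      by (simp only: mult_zero_left fps_const_0_eq_0 diff_0_right add_0_right) algebra
  qed
  show ?thesis
    unfolding d_nabla_def pd sum b
    by (simp add: bform_commute[of _ _ _ "?e k"] algebra_simps)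
qed

lemma jordan_bi_flat_jordan: "jordan_bi_flat \<O> \<epsilon> (jordan_gamma \<epsilon>) (jordan_dual_gamma \<epsilon>) jordan_dual_c"
  unfolding jordan_bi_flat_def bi_flat_F_manifold_def
proof (intro conjI ballI allI)
  fix u :: "('a, 'n) vec" assume u: "u \<in> jordan_domain"
  show bij: "bij (pmult (jordan_c u) (jordan_E u))"
    unfolding pmult_jordan_c jordan_E_def
    by (rule o_bij[of "jprod (inv_E u)"]) (auto simp: jprod_inv_E_cancel ser_nonzero[OF u])
  show "pmult (jordan_dual_c u) v w = inv (pmult (jordan_c u) (jordan_E u)) (pmult (jordan_c u) v w)" for v w
    using bij unfolding pmult_jordan_c jordan_E_def pmult_jordan_dual_c[OF ser_nonzero[OF u]]
    by (metis bij_inv_eq_iff jprod_inv_E_cancel(2) ser_nonzero[OF u])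
  show "lie jordan_e jordan_E u = jordan_e u"
    using lie_eq[OF vec_derivative_const vec_derivative_ident, of "vec_of 1" u]
    by (simp add: jordan_e_eq[abs_def] jordan_E_def[abs_def])
next
  fix X Y :: "('a, 'n) vfield" and u :: "('a, 'n) vec"
  assume "X \<in> vector_fields \<O>" "Y \<in> vector_fields \<O>" and u: "u \<in> jordan_domain"
  then obtain DX DY where D: "vec_derivative X DX u" "vec_derivative Y DY u"
    by (metis vector_field_differentiable)
  have "vmult jordan_c X Y = (\<lambda>y. jprod (X y) (Y y))" for X Y :: "('a, 'n) vfield"
    by (simp add: vmult_def pmult_jordan_c fun_eq_iff)
  then show "lie jordan_E (vmult jordan_c X Y) u - vmult jordan_c (lie jordan_E X) Y u
      - vmult jordan_c X (lie jordan_E Y) u = vmult jordan_c X Y u"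
    using lie_eq[OF vec_derivative_ident vec_derivative_jprod[OF D]]
      lie_eq[OF vec_derivative_ident D(1)] lie_eq[OF vec_derivative_ident D(2)]
    by (simp add: jordan_E_def[abs_def] jprod_diff_left jprod_diff_right)
next
  fix X :: "('a, 'n) vfield" and u :: "('a, 'n) vec" and i j k :: 'n
  assume u: "u \<in> jordan_domain"
  let ?e = "\<lambda>i::'n. fps_X ^ pos i :: 'a fps"
  let ?s = "fps_const (\<epsilon> - 1) * inverse (ser u)" and ?\<kappa> = "\<epsilon> * inverse (fps_nth (ser u) 0)"
  have sum: "(\<Sum>m\<in>UNIV. \<Gamma> i j m * mult_op jordan_c X u m k) = fps_nth (bform \<gamma> s \<kappa> (?e j) (ser (X u) * ?e k)) (pos i)"
    if "\<And>k i j. \<Gamma> k i j = fps_nth (bform \<gamma> s \<kappa> (fps_X ^ pos i) (fps_X ^ pos j)) (pos k)" for \<Gamma> \<gamma> s \<kappa> j k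
    unfolding mult_op_jordan_c sum_bform_nth[of \<Gamma>, OF that]
    using arg_cong[OF bform_ser_vec_of, of "\<lambda>v :: ('a, 'n) vec. v $ i" \<gamma> s \<kappa> "?e j" "ser (X u) * ?e k"]
    by (simp add: jprod_def ser_axis)
  \<comment> \<open>The two connections differ by a function of the triple product alone, which is
    symmetric in the two monomials and drops out of \<open>d_nabla\<close>.\<close>
  have "bform (gamma22_series \<epsilon> u) ?s ?\<kappa> f (ser (X u) * h) = bform (gamma22_series \<epsilon> u) 0 0 f (ser (X u) * h)
     + (?s * (f * h * ser (X u)) - fps_const (?\<kappa> * fps_nth (f * h * ser (X u)) 0))" for f h
    by (simp add: bform_def mult_ac)
  then show "d_nabla (jordan_gamma \<epsilon>) (mult_op jordan_c X) u i j k
      - d_nabla (jordan_dual_gamma \<epsilon>) (mult_op jordan_c X) u i j k = 0"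
    unfolding d_nabla_def sum[OF jordan_gamma_bform] sum[OF jordan_dual_gamma_bform[OF ser_nonzero[OF u]]]
    by (simp add: mult.commute[of "?e k"])
qed (use flat_F_manifold_jordan flat_F_manifold_jordan_dual d_nabla_jordan_V in auto)

end

section \<open>Uniqueness\<close>

lemma pmult_add_right: "pmult c v (w + z) = pmult c v w + pmult c v z"
  by (simp add: vec_eq_iff pmult_def distrib_left sum.distrib)

lemma pmult_add_left: "pmult c (v + w) z = pmult c v z + pmult c w z"
  by (simp add: vec_eq_iff pmult_def algebra_simps sum.distrib)

lemma pmult_scale_right: "pmult c v (a *s w) = a *s pmult c v w"
  by (simp add: vec_eq_iff pmult_def mult_ac sum_distrib_left)

lemma pmult_scale_left: "pmult c (a *s v) w = a *s pmult c v w"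
  by (simp add: vec_eq_iff pmult_def mult_ac sum_distrib_left)

lemma axis_sum:
  fixes f :: "'n::finite \<Rightarrow> 'a::comm_ring_1"
  shows "(\<Sum>j\<in>UNIV. f j * axis i 1 $ j) = f i"
  by (simp add: axis_def if_distrib cong: if_cong)

lemma pmult_axis_left: "pmult c (axis i 1) w $ k = (\<Sum>m\<in>UNIV. c k i m * w $ m)"
proof -
  have "pmult c (axis i 1) w $ k = (\<Sum>m\<in>UNIV. \<Sum>j\<in>UNIV. (c k j m * w $ m) * axis i 1 $ j)"
    unfolding pmult_def by (subst sum.swap) (simp add: mult_ac)
  then show ?thesis by (simp only: axis_sum)
qed

lemma pmult_axis: "pmult c (axis i 1) (axis j 1) $ k = c k i j"
  by (simp only: pmult_axis_left axis_sum)

lemma pmult_pmult_axis: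
  "pmult c (axis i 1) (pmult d (axis j 1) (axis m 1)) $ k = (\<Sum>r\<in>UNIV. c k i r * d r j m)"
  by (simp only: pmult_axis_left[of c] pmult_axis)

lemma symbol_eqI:
  assumes "\<And>v w. pmult c v w = pmult d v w"
  shows "c = d"
  using assms by (intro ext) (metis pmult_axis)

lemma jprod_scale_left: "jprod (a *s v) w = a *s jprod v w"
  by (simp add: jprod_def ser_scale vec_eq_iff mult.assoc)

lemma jprod_scale_right: "jprod v (a *s w) = a *s jprod v w"
  by (simp add: jprod_commute[of v] jprod_scale_left)

lemma linear_eq_on_axes:
  fixes f g :: "'a::comm_ring_1 ^ 'n::finite \<Rightarrow> 'a ^ 'm"
  assumes add: "\<And>v w. f (v + w) = f v + f w" "\<And>v w. g (v + w) = g v + g w"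
    and scale: "\<And>a v. f (a *s v) = a *s f v" "\<And>a v. g (a *s v) = a *s g v"
    and axes: "\<And>i. f (axis i 1) = g (axis i 1)"
  shows "f v = g v"
proof -
  have "f 0 = 0" "g 0 = 0" using scale(1)[of 0 0] scale(2)[of 0 0] by simp_all
  then have "f (\<Sum>i\<in>I. v $ i *s axis i 1) = g (\<Sum>i\<in>I. v $ i *s axis i 1)" for I
    by (induction I rule: infinite_finite_induct) (simp_all add: add scale axes)
  from this[of UNIV] show ?thesis by (simp add: basis_expansion)
qed

text \<open>
  The powers of \<open>t\<close> span the algebra, because \<open>t\<close> generates its maximal ideal: subtracting a
  multiple of \<open>t^d\<close> removes the lowest coefficient of \<open>v\<close>.
\<close>

lemma commuting_vanishes:
  fixes H :: "('a::field, 'n::{finite,linorder}) vec \<Rightarrow> ('a, 'n) vec"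
  assumes add: "\<And>v w. H (v + w) = H v + H w" and scale: "\<And>a v. H (a *s v) = a *s H v"
    and one: "H (vec_of 1) = 0" and t: "\<And>v. H (jprod t v) = jprod t (H v)"
    and t0: "fps_nth (ser t) 0 = 0" and t1: "fps_nth (ser t) 1 \<noteq> 0"
  shows "H v = 0"
proof -
  have H0: "H 0 = 0" using scale[of 0 0] by simp
  have power: "H (vec_of (ser t ^ d)) = 0" for d
  proof (induction d)
    case (Suc d)
    have "jprod t 0 = 0" using jprod_scale_right[of t 0 0] by simp
    moreover have "vec_of (ser t ^ Suc d) = jprod t (vec_of (ser t ^ d))"
      by (simp add: jprod_def vec_of_mult_ser_vec_of)
    ultimately show ?case using Suc by (simp only: t)
  qed (simp add: one)
  \<comment> \<open>The power t^d starts at X^d, with coefficient the d-th power of the linear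
    coefficient of t.\<close>
  have nth: "fps_nth (ser t ^ d) p = (if p < d then 0 else fps_nth (fps_shift 1 (ser t) ^ d) (p - d))" for d p
  proof -
    have "ser t = fps_X * fps_shift 1 (ser t)"
      using fps_decomp[of "ser t"] by (simp add: t0)
    then have "ser t ^ d = fps_X ^ d * fps_shift 1 (ser t) ^ d"
      by (metis power_mult_distrib)
    then show ?thesis by (simp only: fps_X_power_mult_nth)
  qed
  \<comment> \<open>Induction on the number m of top coefficients that may be nonzero; m = n is no
    restriction.\<close>
  have "H v = 0" if "\<And>p. p < CARD('n) - m \<Longrightarrow> fps_nth (ser v) p = 0" for m v
    using that
  proof (induction m arbitrary: v)
    case 0
    have "v $ i = 0" for i using 0[of "pos i"] by simp
    then have "v = 0" by (simp add: vec_eq_iff)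
    then show ?case by (simp add: H0)
  next
    case (Suc m)
    show ?case
    proof (cases "m < CARD('n)")
      case False
      then show ?thesis using Suc by auto
    next
      case True
      define d where "d = CARD('n) - Suc m"
      have d: "d < CARD('n)" "CARD('n) - m = Suc d" using True by (auto simp: d_def)
      \<comment> \<open>Chosen so that subtracting a t^d cancels the coefficient at d, the lowest
        one that may be nonzero.\<close>
      define a where "a = fps_nth (ser v) d / fps_nth (ser t) 1 ^ d"
      have "fps_nth (ser (v + (- a) *s vec_of (ser t ^ d))) p = 0" if "p < CARD('n) - m" for p
      proof (cases "p = d")
        case True
        then show ?thesis
          using t1 by (simp add: ser_diff ser_scale ser_nth_vec_of d nth fps_power_zeroth a_def)
      next
        case False
        with that have "p < d" by (simp add: d)
        with Suc.prems[of p] show ?thesis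
          by (simp add: ser_diff ser_scale ser_nth_vec_of d(1) less_trans[OF _ d(1)] nth d_def)
      qed
      then have "H (v + (- a) *s vec_of (ser t ^ d)) = 0" by (rule Suc.IH)
      then show ?thesis by (simp only: add scale power) simp
    qed
  qed
  from this[of "CARD('n)"] show ?thesis by simp
qed

section \<open>Identities satisfied by every candidate structure\<close>

context jordan_class
begin

text \<open>The structure constants do not depend on the point, so the pencil parameter enters only
  through the quadratic terms.\<close>

lemma curvature_pencil:
  fixes u :: "('a, 'n) vec"
  assumes "regular3 \<O> \<Gamma>" and u: "u \<in> jordan_domain"
  shows "curvature (\<lambda>x k i j. \<Gamma> x k i j - l * jordan_c x k i j) u k m i j
    = curvature \<Gamma> u k m i j
     - l * ((\<Sum>r\<in>UNIV. \<Gamma> u k i r * jordan_c u r j m) + (\<Sum>r\<in>UNIV. jordan_c u k i r * \<Gamma> u r j m)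
          - (\<Sum>r\<in>UNIV. \<Gamma> u k j r * jordan_c u r i m) - (\<Sum>r\<in>UNIV. jordan_c u k j r * \<Gamma> u r i m))
     + l\<^sup>2 * ((\<Sum>r\<in>UNIV. jordan_c u k i r * jordan_c u r j m) - (\<Sum>r\<in>UNIV. jordan_c u k j r * jordan_c u r i m))"
proof -
  have pd: "pd i (\<lambda>y. \<Gamma> y k j m - l * jordan_c y k j m) u = pd i (\<lambda>y. \<Gamma> y k j m) u" for i j
  proof -
    obtain D where D: "K_derivative (\<lambda>y. \<Gamma> y k j m) D u"
      using assms class_differentiable unfolding regular3_def by blast
    have "K_derivative (\<lambda>y. \<Gamma> y k j m - l * jordan_c y k j m) (\<lambda>v. D v - 0) u"
      unfolding jordan_c_def by (rule K_derivative_diff[OF D K_derivative_const])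
    from K_derivative_pd[OF this] K_derivative_pd[OF D] show ?thesis by simp
  qed
  have quad: "(\<Sum>r\<in>UNIV. (\<Gamma> u k i r - l * jordan_c u k i r) * (\<Gamma> u r j m - l * jordan_c u r j m))
     = (\<Sum>r\<in>UNIV. \<Gamma> u k i r * \<Gamma> u r j m)
      - l * ((\<Sum>r\<in>UNIV. \<Gamma> u k i r * jordan_c u r j m) + (\<Sum>r\<in>UNIV. jordan_c u k i r * \<Gamma> u r j m))
      + l\<^sup>2 * (\<Sum>r\<in>UNIV. jordan_c u k i r * jordan_c u r j m)" for i j
    unfolding sum_distrib_left sum.distrib[symmetric] sum_subtractf[symmetric]
    by (intro sum.cong refl) (simp add: algebra_simps power2_eq_square)
  show ?thesis
    unfolding curvature_def pd quad by (simp add: algebra_simps)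
qed

text \<open>This is the vanishing of the coefficient of the pencil parameter in the curvature,
  extended from coordinate fields by linearity in one argument after the other.\<close>

lemma flat_pencil_commutes:
  fixes u :: "('a, 'n) vec"
  assumes \<Gamma>: "regular3 \<O> \<Gamma>" and u: "u \<in> jordan_domain"
    and flat: "\<And>l. flat_on jordan_domain (\<lambda>x k i j. \<Gamma> x k i j - l * jordan_c x k i j)"
  shows "pmult (\<Gamma> u) v (jprod w z) + jprod v (pmult (\<Gamma> u) w z)
       = pmult (\<Gamma> u) w (jprod v z) + jprod w (pmult (\<Gamma> u) v z)"
proof -
  note lin = pmult_add_left pmult_add_right pmult_scale_left pmult_scale_right
    jprod_add_left jprod_add_right jprod_scale_left jprod_scale_right vector_add_ldistrib
  let ?L = "\<lambda>v w z. pmult (\<Gamma> u) v (jprod w z) + jprod v (pmult (\<Gamma> u) w z)"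
  have "?L (axis i 1) (axis j 1) (axis m 1) $ k = ?L (axis j 1) (axis i 1) (axis m 1) $ k" for i j m k
  proof -
    define R0 R1 R2 where
      "R0 = curvature \<Gamma> u k m i j"
      "R1 = (\<Sum>r\<in>UNIV. \<Gamma> u k i r * jordan_c u r j m) + (\<Sum>r\<in>UNIV. jordan_c u k i r * \<Gamma> u r j m)
          - (\<Sum>r\<in>UNIV. \<Gamma> u k j r * jordan_c u r i m) - (\<Sum>r\<in>UNIV. jordan_c u k j r * \<Gamma> u r i m)"
      "R2 = (\<Sum>r\<in>UNIV. jordan_c u k i r * jordan_c u r j m) - (\<Sum>r\<in>UNIV. jordan_c u k j r * jordan_c u r i m)"
    have "R0 - l * R1 + l\<^sup>2 * R2 = 0" for l
      using flat[of l] curvature_pencil[OF \<Gamma> u, of l k m i j] u unfolding flat_on_def R0_R1_R2_def by simp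
    \<comment> \<open>The values at 1 and -1 differ by twice the linear coefficient, and 2 is
      invertible in a normed field.\<close>
    from this[of 1] this[of "-1"] have "R1 + R1 = 0" by simp algebra
    then have "R1 = 0" by (metis mult_2 mult_eq_0_iff zero_neq_numeral)
    then show ?thesis
      unfolding R0_R1_R2_def pmult_jordan_c[of u, symmetric] vector_add_component pmult_pmult_axis
      by (simp add: algebra_simps)
  qed
  then have "?L (axis i 1) (axis j 1) (axis m 1) = ?L (axis j 1) (axis i 1) (axis m 1)" for i j m
    by (simp add: vec_eq_iff)
  then have "?L (axis i 1) (axis j 1) z = ?L (axis j 1) (axis i 1) z" for i j
    by - (rule linear_eq_on_axes[where f = "?L (axis i 1) (axis j 1)" and g = "?L (axis j 1) (axis i 1)"],
      simp_all add: lin)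
  then have "?L (axis i 1) w z = ?L w (axis i 1) z" for i
    by - (rule linear_eq_on_axes[where f = "\<lambda>w. ?L (axis i 1) w z" and g = "\<lambda>w. ?L w (axis i 1) z"],
      simp_all add: lin)
  then show ?thesis
    by - (rule linear_eq_on_axes[where f = "\<lambda>v. ?L v w z" and g = "\<lambda>v. ?L w v z"],
      simp_all add: lin)
qed

lemma pmult_symmetric:
  assumes "\<And>k i j. c k i j = c k j i"
  shows "pmult c v w = pmult c w v"
  unfolding pmult_def vec_eq_iff by (simp, subst sum.swap) (simp add: assms mult_ac)

lemma nabla_vector_eq_pmult: "nabla_vector \<Gamma> X x k j = pd j (\<lambda>y. X y $ k) x + pmult (\<Gamma> x) (axis j 1) (X x) $ k"
  by (simp add: nabla_vector_def pmult_axis_left)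

lemma d_nabla_eq_pmult:
  "d_nabla \<Gamma> V x i j k = pd j (\<lambda>y. V y i k) x - pd k (\<lambda>y. V y i j) x
    + pmult (\<Gamma> x) (axis j 1) (\<chi> m. V x m k) $ i - pmult (\<Gamma> x) (axis k 1) (\<chi> m. V x m j) $ i"
  by (simp add: d_nabla_def pmult_axis_left)

lemma jordan_bi_flatD:
  fixes u :: "('a, 'n) vec"
  assumes B: "jordan_bi_flat \<O> \<epsilon> \<Gamma> \<Gamma>s cs" and u: "u \<in> jordan_domain"
  shows "pmult (\<Gamma> u) v w = pmult (\<Gamma> u) w v"
    and "pmult (\<Gamma> u) v (vec_of 1) = 0"
    and "pmult (\<Gamma> u) v (jprod w z) + jprod v (pmult (\<Gamma> u) w z)
       = pmult (\<Gamma> u) w (jprod v z) + jprod w (pmult (\<Gamma> u) v z)"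
    and "d_nabla \<Gamma> (jordan_V \<epsilon>) u i j k = 0"
    and "nabla_vector \<Gamma>s jordan_E u i j = 0"
    and "d_nabla \<Gamma> (mult_op jordan_c (\<lambda>_. v)) u i j k = d_nabla \<Gamma>s (mult_op jordan_c (\<lambda>_. v)) u i j k"
    and "pmult (cs u) v w = inv (pmult (jordan_c u) u) (jprod v w)"
proof -
  note b = B[unfolded jordan_bi_flat_def bi_flat_F_manifold_def]
  then have f: "flat_F_manifold \<O> jordan_domain \<Gamma> jordan_c jordan_e" by blast
  show "pmult (\<Gamma> u) v (jprod w z) + jprod v (pmult (\<Gamma> u) w z)
       = pmult (\<Gamma> u) w (jprod v z) + jprod w (pmult (\<Gamma> u) v z)"
    using f unfolding flat_F_manifold_def by (intro flat_pencil_commutes u) blast+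
  have "torsionless_on jordan_domain (\<lambda>x k i j. \<Gamma> x k i j - 0 * jordan_c x k i j)"
    using f unfolding flat_F_manifold_def by blast
  with u show "pmult (\<Gamma> u) v w = pmult (\<Gamma> u) w v"
    by (intro pmult_symmetric) (simp add: torsionless_on_def)
  have "nabla_vector \<Gamma> jordan_e u k j = 0" for k j
    using f u unfolding flat_F_manifold_def by blast
  moreover have "pd j (\<lambda>y :: ('a, 'n) vec. jordan_e y $ k) u = 0" for j k
    unfolding jordan_e_eq by (rule K_derivative_pd[OF K_derivative_const])
  ultimately have "pmult (\<Gamma> u) (axis j 1) (vec_of 1) = 0" for j
    by (simp add: nabla_vector_eq_pmult vec_eq_iff jordan_e_eq)
  then show "pmult (\<Gamma> u) v (vec_of 1) = 0"
    by - (rule linear_eq_on_axes[where f = "\<lambda>v. pmult (\<Gamma> u) v (vec_of 1)" and g = "\<lambda>v. 0"],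
      simp_all add: pmult_add_left pmult_scale_left)
  show "d_nabla \<Gamma> (jordan_V \<epsilon>) u i j k = 0" using b u by blast
  show "nabla_vector \<Gamma>s jordan_E u i j = 0"
    using b u unfolding flat_F_manifold_def by blast
  \<comment> \<open>Constant fields suffice for comparing the two connections at a point.\<close>
  have "(\<lambda>_. v) \<in> vector_fields \<O>" by (simp add: vector_fields_def class_const)
  then show "d_nabla \<Gamma> (mult_op jordan_c (\<lambda>_. v)) u i j k = d_nabla \<Gamma>s (mult_op jordan_c (\<lambda>_. v)) u i j k"
    using b u by (metis (no_types, lifting) eq_iff_diff_eq_0)
  show "pmult (cs u) v w = inv (pmult (jordan_c u) u) (jprod v w)"
    using b u by (simp add: pmult_jordan_c jordan_E_def)
qed

text \<open>Evaluated on a coordinate field and e, the condition on L - a_0 I determines the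
  connection on E by derivatives of this tensor alone, so all candidates agree there.\<close>

lemma pmult_bi_flat_E:
  fixes u :: "('a, 'n) vec"
  assumes B: "jordan_bi_flat \<O> \<epsilon> \<Gamma> \<Gamma>s cs" and u: "u \<in> jordan_domain"
  shows "pmult (\<Gamma> u) v u = pmult (jordan_gamma \<epsilon> u) v u"
proof -
  obtain o1 :: 'n where o1: "pos o1 = 0" using obtain_pos[of 0] by auto
  have ax: "axis o1 1 = (vec_of 1 :: ('a, 'n) vec)"
    using pos_eq_iff[of _ o1] by (auto simp: vec_eq_iff axis_def o1)
  have V: "(\<chi> m. jordan_V \<epsilon> u m o1) = u + (- (\<epsilon> * coord u 1)) *s vec_of 1"
  proof -
    have "jprod u (axis o1 1) = u" by (simp only: ax jprod_commute[of u] jprod_e)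
    then show ?thesis
      unfolding ax[symmetric] by (simp add: vec_eq_iff jordan_V_def mult_op_jordan_c jordan_E_def axis_def)
  qed
  \<comment> \<open>The column at the first index is E - a_0 e, and every term in which e is an
    argument of the connection vanishes.\<close>
  have "pmult (\<Gamma> u) (axis j 1) u $ i = pd o1 (\<lambda>y. jordan_V \<epsilon> y i j) u - pd j (\<lambda>y. jordan_V \<epsilon> y i o1) u"
    if B: "jordan_bi_flat \<O> \<epsilon> \<Gamma> \<Gamma>s cs" for \<Gamma> \<Gamma>s cs i j
    using jordan_bi_flatD(4)[OF B u, of i j o1]
    unfolding d_nabla_eq_pmult V ax pmult_add_right pmult_scale_right jordan_bi_flatD(2)[OF B u]
      jordan_bi_flatD(1)[OF B u, of "vec_of 1"]
    by (simp add: algebra_simps)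
  from this[OF B] this[OF jordan_bi_flat_jordan] have "pmult (\<Gamma> u) (axis j 1) u
      = pmult (jordan_gamma \<epsilon> u) (axis j 1) u" for j
    by (simp add: vec_eq_iff)
  then show ?thesis
    by - (rule linear_eq_on_axes[where f = "\<lambda>v. pmult (\<Gamma> u) v u" and g = "\<lambda>v. pmult (jordan_gamma \<epsilon> u) v u"],
      simp_all add: pmult_add_left pmult_scale_left)
qed

lemma connection_unique:
  fixes u :: "('a, 'n) vec"
  assumes B: "jordan_bi_flat \<O> \<epsilon> \<Gamma> \<Gamma>s cs" and u: "u \<in> jordan_domain"
  shows "\<Gamma> u = jordan_gamma \<epsilon> u"
proof (rule symbol_eqI)
  fix v w
  define H where "H v w = pmult (\<Gamma> u) v w - pmult (jordan_gamma \<epsilon> u) v w" for v w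
  define t where "t = u + (- fps_nth (ser u) 0) *s vec_of 1"
  note J = jordan_bi_flatD[OF jordan_bi_flat_jordan u] and G = jordan_bi_flatD[OF B u]
  have add: "H v (w + z) = H v w + H v z" and scale: "H v (a *s w) = a *s H v w" for a v w z
    by (simp_all add: H_def pmult_add_right pmult_scale_right vector_sub_rdistrib vector_ssub_ldistrib)
  have sym: "H v w = H w v" for v w by (simp add: H_def G(1)[of v] J(1)[of v])
  have e: "H v (vec_of 1) = 0" for v by (simp add: H_def G(2) J(2))
  have Ht: "H v t = 0" for v
    unfolding t_def add scale e by (simp add: H_def pmult_bi_flat_E[OF B u])
  have "H v (jprod t w) = jprod t (H v w)" for w
  proof -
    \<comment> \<open>The identities for the two connections are subtracted; products of
      \<open>jprod\<close> alone do not occur in them, so the difference is linear in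
      \<open>H\<close>.\<close>
    have "H v (jprod t w) + jprod v (H t w) = H t (jprod v w) + jprod t (H v w)"
      using G(3)[of v t w] J(3)[of v t w] unfolding H_def jprod_diff_right by (simp add: algebra_simps)
    moreover have "H t z = 0" for z using Ht[of z] by (simp add: sym)
    moreover have "jprod v 0 = 0" using jprod_scale_right[of v 0 0] by simp
    ultimately show ?thesis by simp
  qed
  \<comment> \<open>Removing the constant term leaves u^2 as the linear coefficient of t; it is
    nonzero on the domain.\<close>
  moreover have "ser t = ser u + fps_const (- fps_nth (ser u) 0)"
    by (simp only: t_def ser_add ser_scale ser_vec_of_1 mult_1_right)
  then have "fps_nth (ser t) 0 = 0" "fps_nth (ser t) 1 \<noteq> 0" using u by (simp_all add: jordan_domain_iff)
  ultimately have "H v w = 0" by (intro commuting_vanishes[OF add scale e])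
  then show "pmult (\<Gamma> u) v w = pmult (jordan_gamma \<epsilon> u) v w" by (simp add: H_def)
qed

lemma dual_connection_unique:
  fixes u :: "('a, 'n) vec"
  assumes B: "jordan_bi_flat \<O> \<epsilon> \<Gamma> \<Gamma>s cs" and u: "u \<in> jordan_domain"
  shows "\<Gamma>s u = jordan_dual_gamma \<epsilon> u"
proof (rule symbol_eqI)
  fix v w
  define H where "H v w = pmult (\<Gamma>s u) v w - pmult (jordan_dual_gamma \<epsilon> u) v w" for v w
  note J = jordan_bi_flatD[OF jordan_bi_flat_jordan u] and G = jordan_bi_flatD[OF B u]
  note lin = pmult_add_left pmult_add_right pmult_scale_left pmult_scale_right jprod_add_right
    jprod_scale_right H_def vector_ssub_ldistrib
  obtain o1 :: 'n where o1: "pos o1 = 0" using obtain_pos[of 0] by auto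
  have ax: "axis o1 1 = (vec_of 1 :: ('a, 'n) vec)"
    using pos_eq_iff[of _ o1] by (auto simp: vec_eq_iff axis_def o1)
  \<comment> \<open>Both dual connections annihilate E, and the coordinate derivatives of E cancel
    in the difference.\<close>
  have "H (axis j 1) u = 0" for j
    using G(5)[of _ j] J(5)[of _ j]
    by (simp add: H_def nabla_vector_eq_pmult vec_eq_iff jordan_E_def add_eq_0_iff)
  then have E: "H v u = 0" for v
    by - (rule linear_eq_on_axes[where f = "\<lambda>v. H v u" and g = "\<lambda>v. 0"], simp_all add: lin)
  \<comment> \<open>The primal connections already agree, so both dual ones have the same
    \<open>d_nabla\<close> on x as an operator; inserting e for the second direction gives the
    formula.\<close>
  have "H (axis j 1) x = H (vec_of 1) (jprod x (axis j 1))" for j x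
  proof -
    have col: "(\<chi> m. mult_op jordan_c (\<lambda>_. x) u m k) = jprod x (axis k 1)" for k
      by (simp add: vec_eq_iff mult_op_jordan_c)
    have "d_nabla \<Gamma> V u i j k = d_nabla (jordan_gamma \<epsilon>) V u i j k" for V i j k
      by (simp add: d_nabla_def connection_unique[OF B u])
    then have "d_nabla \<Gamma>s (mult_op jordan_c (\<lambda>_. x)) u i j o1
        = d_nabla (jordan_dual_gamma \<epsilon>) (mult_op jordan_c (\<lambda>_. x)) u i j o1" for i
      using G(6) J(6) by metis
    then show ?thesis
      by (simp add: d_nabla_eq_pmult col ax jprod_commute[of x "vec_of 1"] jprod_e H_def vec_eq_iff algebra_simps)
  qed
  then have X: "H v x = H (vec_of 1) (jprod x v)" for v x
    by - (rule linear_eq_on_axes[where f = "\<lambda>v. H v x" and g = "\<lambda>v. H (vec_of 1) (jprod x v)"],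
      simp_all add: lin)
  \<comment> \<open>Every vector z is E times E^-1 z, so vanishing on multiples of E
    suffices.\<close>
  then have "H (vec_of 1) (jprod u (jprod (inv_E u) z)) = 0" for z by (metis E)
  then have "H (vec_of 1) z = 0" for z
    by (simp add: jprod_inv_E_cancel ser_nonzero[OF u])
  then have "H v w = 0" by (simp only: X[of v w])
  then show "pmult (\<Gamma>s u) v w = pmult (jordan_dual_gamma \<epsilon> u) v w" by (simp add: H_def)
qed

text \<open>The bi-flat condition itself expresses the dual product by the primal one and the
  inverse of multiplication by E.\<close>

lemma dual_product_unique:
  assumes "jordan_bi_flat \<O> \<epsilon> \<Gamma> \<Gamma>s cs" and u: "(u :: ('a, 'n) vec) \<in> jordan_domain"
  shows "cs u = jordan_dual_c u"
  by (rule symbol_eqI) (simp add: jordan_bi_flatD(7)[OF assms] jordan_bi_flatD(7)[OF jordan_bi_flat_jordan u])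

lemma jordan_bi_flat_exists_unique:
  "jordan_bi_flat \<O> \<epsilon> (jordan_gamma \<epsilon>) (jordan_dual_gamma \<epsilon>) jordan_dual_c \<and>
    (\<forall>\<Gamma> \<Gamma>s cs. jordan_bi_flat \<O> \<epsilon> \<Gamma> \<Gamma>s cs \<longrightarrow>
       (\<forall>u\<in>jordan_domain. \<Gamma> u = jordan_gamma \<epsilon> u \<and> \<Gamma>s u = jordan_dual_gamma \<epsilon> u \<and>
          cs u = jordan_dual_c u))"
  using jordan_bi_flat_jordan connection_unique dual_connection_unique dual_product_unique by blast

end

theorem theorem7p6:
  fixes \<epsilon> :: real and \<eta> :: complex
  assumes "CARD('n::{finite,linorder}) \<ge> 2"
  shows
    "(let \<O> = smooth_functions (jordan_domain :: (real ^ 'n::{finite,linorder}) set) in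
        jordan_bi_flat \<O> \<epsilon> (jordan_gamma \<epsilon>) (jordan_dual_gamma \<epsilon>) jordan_dual_c \<and>
        (\<forall>\<Gamma> \<Gamma>s cs. jordan_bi_flat \<O> \<epsilon> \<Gamma> \<Gamma>s cs \<longrightarrow>
           (\<forall>u\<in>jordan_domain. \<Gamma> u = jordan_gamma \<epsilon> u \<and> \<Gamma>s u = jordan_dual_gamma \<epsilon> u \<and>
              cs u = jordan_dual_c u)))
   \<and> (let \<O> = holomorphic_functions (jordan_domain :: (complex ^ 'n::{finite,linorder}) set) in
        jordan_bi_flat \<O> \<eta> (jordan_gamma \<eta>) (jordan_dual_gamma \<eta>) jordan_dual_c \<and>
        (\<forall>\<Gamma> \<Gamma>s cs. jordan_bi_flat \<O> \<eta> \<Gamma> \<Gamma>s cs \<longrightarrow>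
           (\<forall>u\<in>jordan_domain. \<Gamma> u = jordan_gamma \<eta> u \<and> \<Gamma>s u = jordan_dual_gamma \<eta> u \<and>
              cs u = jordan_dual_c u)))"
proof -
  interpret R: jordan_class "smooth_functions (jordan_domain :: (real, 'n) vec set)" \<epsilon>
    unfolding jordan_class_def by (rule function_class_smooth[OF open_jordan_domain])
  interpret C: jordan_class "holomorphic_functions (jordan_domain :: (complex, 'n) vec set)" \<eta>
    unfolding jordan_class_def by (rule function_class_holomorphic[OF open_jordan_domain])
  show ?thesis
    unfolding Let_def using R.jordan_bi_flat_exists_unique C.jordan_bi_flat_exists_unique by (rule conjI)
qed

end
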